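(* Let $f$ be a Bernstein function satisfying (A1) and (A2), with Lévy tail $\bar\mu$ and positive Sonine pair $(\bar\mu,k)$, so that $\mathcal L(\bar\mu;\lambda)=f(\lambda)/\lambda$ and $\mathcal L(k;\lambda)=1/f(\lambda)$. If $\limsup_{x\to 0}\bar\mu(x)\int_0^x k(s)\,ds<1$, then for every $\phi_0\in\mathbb R$, $T>0$ and $g\in C[0,T]$ there exists a unique function $\phi\in C_{\bar\mu}[0,T]$ such that $$D^f_{\mathrm{Ce}}\phi(x)=g(x)\quad\text{for } x\in(0,T],\qquad \phi(0)=\phi_0 .$$ The function $\phi$ is given by the series representation $$\phi(x)-\phi_0=I^f_{\mathrm{Ce}}g(x)=\sum_{i=0}^\infty \mathcal K^i\big[I^f_{\mathrm R}g\big](x),\qquad x\in[0,T].$$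
   Context: A Bernstein function with triplet $(a,b,\mu)$ is a function $f(\lambda)=a+b\lambda+\int_{(0,\infty)}(1-e^{-\lambda t})\,\mu(dt)$, $\lambda>0$, with $a,b\ge0$ and $\mu$ a Borel measure on $(0,\infty)$ with $\int\min\{1,t\}\,\mu(dt)<\infty$. Assumptions: (A1) $f$ is a Bernstein function with $f(0+)=0$, $\lim_{x\to\infty}f(x)=\infty$, $\lim_{x\to0}f(x)/x=\infty$, $\lim_{x\to\infty}f(x)/x=0$ (hence the triplet is $(0,0,\mu)$); (A2) $f$ is a complete Bernstein function, i.e. $\mu$ has a completely monotone density with respect to Lebesgue measure. Put $\bar\mu(x)=\mu((x,\infty))$, $x>0$. The conjugate $f^*(x)=x/f(x)$ is again a complete Bernstein function; let $\mu^*$ be its Lévy measure and $k(x)=\mu^*((x,\infty))$, $x>0$. Then $\bar\mu,k$ are completely monotone, locally integrable on $[0,\infty)$, and $(\bar\mu,k)$ is a positive Sonine pair: $\int_0^x\bar\mu(x-t)k(t)\,dt=1$ for all $x>0$; here $\mathcal L(h;\lambda)=\int_0^\infty e^{-\lambda x}h(x)\,dx$. Convolution: $(\bar\mu*\phi)(x)=\int_0^x\bar\mu(x-t)\phi(t)\,dt$. Function spaces: $C_{\bar\mu}(0,T]=\{\phi\in C(0,T]\cap L^1(0,T): \bar\mu*\phi\in C^1(0,T]\}$ (one-sided derivative at $T$) and $C_{\bar\mu}[0,T]=C[0,T]\cap C_{\bar\mu}(0,T]$. Bernstein–Riemann–Liouville derivative: $D^f_{\mathrm R}\phi(x)=\frac{d}{dx}\int_0^x\phi(x-t)\bar\mu(t)\,dt$.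 Censored Bernstein derivative: $D^f_{\mathrm{Ce}}\phi(x)=D^f_{\mathrm R}\phi(x)-\phi(x)\bar\mu(x)$ for $\phi\in C_{\bar\mu}(0,T]$, $x\in(0,T]$. Bernstein–Riemann–Liouville integral: $I^f_{\mathrm R}\phi(x)=\int_0^x\phi(x-z)k(z)\,dz$ for $x>0$, with value $0$ at $x=0$ for $\phi\in C[0,T]$. Operator $\mathcal K$: $\mathcal K\phi(x)=\int_0^x\bar\mu(r)k(x-r)\phi(r)\,dr$ for $x>0$, $\mathcal K\phi(0)=\phi(0)$; $\mathcal K^i$ is the $i$-fold iterate, $\mathcal K^0$ the identity. The censored integral $I^f_{\mathrm{Ce}}g$ is defined by the series $\sum_{i=0}^\infty\mathcal K^i[I^f_{\mathrm R}g]$. *)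

theory Defs
  imports "HOL-Analysis.Analysis"
begin

text \<open>
  The measure lives on the subspace \<open>(0,\<infinity>)\<close> itself, so integrals with respect to it are integrals
  over \<open>(0,\<infinity>)\<close>. Only the values of \<open>f\<close> on \<open>(0,\<infinity>)\<close> matter.
\<close>

definition bernstein_triplet :: "(real \<Rightarrow> real) \<Rightarrow> real \<Rightarrow> real \<Rightarrow> real measure \<Rightarrow> bool" where
  "bernstein_triplet f a b \<mu> \<longleftrightarrow>
     a \<ge> 0 \<and> b \<ge> 0 \<and> sets \<mu> = sets (restrict_space borel {0<..}) \<and>
     (\<integral>\<^sup>+ t. ennreal (min 1 t) \<partial>\<mu>) < \<infinity> \<and>
     (\<forall>l>0. f l = a + b * l + (\<integral> t. (1 - exp (- l * t)) \<partial>\<mu>))"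

definition completely_monotone :: "(real \<Rightarrow> real) \<Rightarrow> bool" where
  "completely_monotone m \<longleftrightarrow>
     (\<forall>n. \<forall>x>0. (deriv ^^ n) m field_differentiable (at x) \<and> (- 1) ^ n * (deriv ^^ n) m x \<ge> 0)"

definition complete_bernstein_triplet ::
    "(real \<Rightarrow> real) \<Rightarrow> real \<Rightarrow> real \<Rightarrow> real measure \<Rightarrow> bool" where
  "complete_bernstein_triplet f a b \<mu> \<longleftrightarrow>
     bernstein_triplet f a b \<mu> \<and>
     (\<exists>m. completely_monotone m \<and>
        \<mu> = density (restrict_space lborel {0<..}) (\<lambda>t. ennreal (m t)))"

definition conjugate_bernstein :: "(real \<Rightarrow> real) \<Rightarrow> real \<Rightarrow> real" where
  "conjugate_bernstein f x = x / f x"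

text \<open>Finite for \<open>x > 0\<close> when \<open>\<mu>\<close> is a Levy measure; used only there.\<close>

definition levy_tail :: "real measure \<Rightarrow> real \<Rightarrow> real" where
  "levy_tail \<mu> x = measure \<mu> {x<..}"

definition convolution :: "(real \<Rightarrow> real) \<Rightarrow> (real \<Rightarrow> real) \<Rightarrow> real \<Rightarrow> real" where
  "convolution h \<phi> x = (LBINT t:{0<..<x}. h (x - t) * \<phi> t)"

text \<open>
  Functions on \<open>[0,T]\<close> or \<open>(0,T]\<close> are represented by total functions whose values elsewhere are
  irrelevant; derivatives are therefore taken within \<open>(0,T]\<close>, which makes them two-sided in the
  interior and one-sided at \<open>T\<close>.
\<close>

definition C1_left_open :: "real \<Rightarrow> (real \<Rightarrow> real) set" where
  "C1_left_open T = {F. \<exists>F'. continuous_on {0<..T} F' \<and>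
     (\<forall>x\<in>{0<..T}. (F has_real_derivative F' x) (at x within {0<..T}))}"

definition C_left_open :: "(real \<Rightarrow> real) \<Rightarrow> real \<Rightarrow> (real \<Rightarrow> real) set" where
  "C_left_open \<mu>bar T = {\<phi>. continuous_on {0<..T} \<phi> \<and> set_integrable lborel {0<..<T} \<phi> \<and>
     convolution \<mu>bar \<phi> \<in> C1_left_open T}"

definition C_closed :: "(real \<Rightarrow> real) \<Rightarrow> real \<Rightarrow> (real \<Rightarrow> real) set" where
  "C_closed \<mu>bar T = {\<phi>. continuous_on {0..T} \<phi>} \<inter> C_left_open \<mu>bar T"

definition RL_derivative :: "(real \<Rightarrow> real) \<Rightarrow> real \<Rightarrow> (real \<Rightarrow> real) \<Rightarrow> real \<Rightarrow> real" where
  "RL_derivative \<mu>bar T \<phi> x =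
     vector_derivative (\<lambda>y. LBINT t:{0<..<y}. \<phi> (y - t) * \<mu>bar t) (at x within {0<..T})"

definition censored_derivative :: "(real \<Rightarrow> real) \<Rightarrow> real \<Rightarrow> (real \<Rightarrow> real) \<Rightarrow> real \<Rightarrow> real" where
  "censored_derivative \<mu>bar T \<phi> x = RL_derivative \<mu>bar T \<phi> x - \<phi> x * \<mu>bar x"

text \<open>The interval of integration is empty at \<open>x = 0\<close>, so the value there is \<open>0\<close>.\<close>

definition RL_integral :: "(real \<Rightarrow> real) \<Rightarrow> (real \<Rightarrow> real) \<Rightarrow> real \<Rightarrow> real" where
  "RL_integral k \<phi> x = (LBINT z:{0<..<x}. \<phi> (x - z) * k z)"

definition K_op ::
    "(real \<Rightarrow> real) \<Rightarrow> (real \<Rightarrow> real) \<Rightarrow> (real \<Rightarrow> real) \<Rightarrow> real \<Rightarrow> real" where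
  "K_op \<mu>bar k \<phi> x =
     (if x = 0 then \<phi> 0 else (LBINT r:{0<..<x}. \<mu>bar r * k (x - r) * \<phi> r))"

definition censored_integral ::
    "(real \<Rightarrow> real) \<Rightarrow> (real \<Rightarrow> real) \<Rightarrow> (real \<Rightarrow> real) \<Rightarrow> real \<Rightarrow> real" where
  "censored_integral \<mu>bar k g x = (\<Sum>i. (K_op \<mu>bar k ^^ i) (RL_integral k g) x)"

end

theory Submission
  imports Defs
begin

text \<open>
  Integrating the Bernstein representations gives Laplace transforms \<open>f(l)/l\<close> and \<open>1/f(l)\<close> for the two
  tails; their product is \<open>1/l\<close>, so uniqueness of Laplace transforms yields the Sonine identity
  \<open>A * k = 1\<close>, where \<open>A\<close> is the tail of \<open>\<mu>\<close>. Put \<open>\<kappa>(x) = \<integral>\<^sub>0\<^sup>x k\<close>. As \<open>A\<close> decreases, \<open>A \<kappa> \<le> A * k = 1\<close>, and the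
  inequality is strict: if \<open>A\<close> were constant on some \<open>[y,x]\<close>, the decreasing density of \<open>\<mu>\<close> would vanish beyond \<open>x\<close>
  and hence \<open>A(x) = 0\<close>. With the hypothesis at \<open>0\<close> and continuity, \<open>q = sup A \<kappa> < 1\<close> on \<open>(0,T]\<close>, whence
  \<open>|\<phi>| \<le> c \<kappa>\<close> implies \<open>|K \<phi>| \<le> c q \<kappa>\<close>: the series converges uniformly to a solution of \<open>u = k * (g + A u)\<close>.
  Convolving with \<open>A\<close> gives \<open>A * u = 1 * (g + A u)\<close>, which is the equation. Conversely, the difference of
  two solutions is a fixed point of \<open>K\<close> vanishing at \<open>0\<close>; it satisfies \<open>|v| \<le> e + c \<kappa>\<close> for every \<open>e > 0\<close>
  and some \<open>c\<close>, and iterating \<open>K\<close> improves this to \<open>|v| \<le> e + c q\<^sup>n \<kappa>\<close>.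
\<close>

section \<open>Laplace transforms\<close>

text \<open>\<open>K\<close> averages: its kernel k(x - r) A(r) is nonnegative with integral 1 over
  (0, x). Thus constants are fixed, and no contraction is visible in the supremum norm. It appears
  in the weighted norm sup |\<phi>| / \<kappa>. This weight is natural: \<kappa> is the
  Riemann-Liouville integral of 1, so k * g lies in the weighted space for every bounded g, and K
  \<kappa> = k * (A \<kappa>) \<le> q (k * 1) = q \<kappa>. The weight also compensates the
  singularity of A at 0. The difference of two solutions is merely continuous and tends to 0 at 0
  with no rate against \<kappa>. Uniqueness can therefore not be read off in the weighted norm; an
  additive error e is carried along, which an averaging operator does not enlarge. Laplace
  uniqueness by itself identifies functions up to null sets, whereas the contraction argument uses
  the Sonine identity at every x > 0. Hence the convolution of two decreasing kernels, possibly both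
  singular at 0, has to be shown finite and continuous on (0, \<infinity>) before uniqueness is
  applied.\<close>

lemma AE_lborel_interval_ex:
  fixes a b :: real
  assumes "AE x in lborel. P x" and "a < b"
  shows "\<exists>x\<in>{a<..<b}. P x"
proof (rule ccontr)
  assume n: "\<not> (\<exists>x\<in>{a<..<b}. P x)"
  have "AE x in lborel. x \<notin> {a<..<b}"
    using assms(1) by eventually_elim (use n in auto)
  hence "emeasure lborel {a<..<b} = 0"
    by (subst (asm) AE_iff_measurable[of "{a<..<b}"]) auto
  with \<open>a < b\<close> show False by simp
qed

text \<open>Under u = exp (- x) the transform at n + 1 is the n-th moment of a finite signed density
  on [0, 1], namely the image of exp (- x) d x. All moments vanish, so polynomials integrate to 0,
  and Weierstrass approximation extends this to continuous \<open>c\<close>.\<close>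

lemma Laplace_transform_zero:
  fixes d :: "real \<Rightarrow> real"
  assumes int: "set_integrable lborel {0<..} (\<lambda>x. exp (- x) * d x)"
    and zero: "\<And>n::nat. (LBINT x:{0<..}. exp (- real (Suc n) * x) * d x) = 0"
    and c_cont: "continuous_on {0..1} c"
  shows "(LBINT x:{0<..}. c (exp (- x)) * (exp (- x) * d x)) = 0"
proof -
  let ?D = "\<lambda>x. indicator {0<..} x * (exp (- x) * d x)"
  have D: "integrable lborel ?D"
    using int by (simp add: set_integrable_def)
  hence Dm: "?D \<in> borel_measurable lborel" by auto
  have expb: "exp (- x) \<in> {0..1}" if "x > 0" for x :: real using that by auto
  have mpoly: "integrable lborel (\<lambda>x. exp (- x) ^ i * ?D x)"
     "(LINT x|lborel. exp (- x) ^ i * ?D x) = 0" for i :: nat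
  proof -
    show "integrable lborel (\<lambda>x. exp (- x) ^ i * ?D x)"
    proof (rule Bochner_Integration.integrable_bound[OF D])
      show "AE x in lborel. norm (exp (- x) ^ i * ?D x) \<le> norm (?D x)"
        by (auto simp: abs_mult indicator_def intro!: mult_left_le_one_le power_le_one)
    qed (use Dm in measurable)
    have "(LINT x|lborel. exp (- x) ^ i * ?D x) = (LBINT x:{0<..}. exp (- real (Suc i) * x) * d x)"
      unfolding set_lebesgue_integral_def
      by (intro Bochner_Integration.integral_cong)
        (auto simp: indicator_def exp_of_nat_mult[symmetric] mult_exp_exp algebra_simps)
    thus "(LINT x|lborel. exp (- x) ^ i * ?D x) = 0" using zero by simp
  qed
  define M where "M = (LINT x|lborel. \<bar>?D x\<bar>)"
  have cm: "(\<lambda>x. indicator {0<..} x * c (exp (- x))) \<in> borel_measurable borel"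
  proof -
    have "continuous_on {0<..} (\<lambda>x::real. c (exp (- x)))"
      by (rule continuous_on_compose2[OF c_cont]) (auto intro!: continuous_intros)
    from borel_measurable_continuous_on_indicator[OF _ this] show ?thesis by simp
  qed
  have cmD: "(\<lambda>x. c (exp (- x)) * ?D x) \<in> borel_measurable lborel"
  proof -
    have "(\<lambda>x. c (exp (- x)) * ?D x) = (\<lambda>x. (indicator {0<..} x * c (exp (- x))) * ?D x)"
      by (auto simp: indicator_def)
    thus ?thesis using cm Dm by simp
  qed
  \<comment> \<open>The approximating polynomial contributes nothing, so only the error of size
    \<open>e\<close> against the total mass \<open>M\<close> remains.\<close>
  have "\<bar>LINT x|lborel. c (exp (- x)) * ?D x\<bar> \<le> e * M" if e: "e > 0" for e
  proof -
    obtain p where p: "real_polynomial_function p" "\<And>u. u \<in> {0..1} \<Longrightarrow> \<bar>c u - p u\<bar> < e"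
      using Stone_Weierstrass_real_polynomial_function[OF _ c_cont e] by auto
    obtain a n where pa: "p = (\<lambda>x. \<Sum>i\<le>n::nat. a i * x ^ i)"
      using p(1) by (auto simp: real_polynomial_function_iff_sum)
    have ip: "integrable lborel (\<lambda>x. p (exp (- x)) * ?D x)"
      and p0: "(LINT x|lborel. p (exp (- x)) * ?D x) = 0"
    proof -
      have eq: "p (exp (- x)) * ?D x = (\<Sum>i\<le>n. a i * (exp (- x) ^ i * ?D x))" for x
        by (simp add: pa sum_distrib_right mult.assoc)
      show "integrable lborel (\<lambda>x. p (exp (- x)) * ?D x)"
        unfolding eq by (intro Bochner_Integration.integrable_sum integrable_mult_right mpoly)
      have "(LINT x|lborel. p (exp (- x)) * ?D x) = (\<Sum>i\<le>n. a i * (LINT x|lborel. exp (- x) ^ i * ?D x))"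
        unfolding eq using mpoly(1) by (subst Bochner_Integration.integral_sum) auto
      thus "(LINT x|lborel. p (exp (- x)) * ?D x) = 0" by (simp only: mpoly(2)) simp
    qed
    have bd: "norm (c (exp (- x)) * ?D x - p (exp (- x)) * ?D x) \<le> e * \<bar>?D x\<bar>" for x
    proof (cases "x > 0")
      case True
      have "norm (c (exp (- x)) * ?D x - p (exp (- x)) * ?D x) = \<bar>c (exp (- x)) - p (exp (- x))\<bar> * \<bar>?D x\<bar>"
        by (simp add: abs_mult[symmetric] algebra_simps)
      also have "\<dots> \<le> e * \<bar>?D x\<bar>"
        using p(2)[OF expb[OF True]] by (intro mult_right_mono) auto
      finally show ?thesis .
    qed simp
    have pm: "(\<lambda>x. p (exp (- x)) * ?D x) \<in> borel_measurable lborel" using ip by auto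
    have ieD: "integrable lborel (\<lambda>x. e * \<bar>?D x\<bar>)" using D by auto
    have id: "integrable lborel (\<lambda>x. c (exp (- x)) * ?D x - p (exp (- x)) * ?D x)"
      using cmD pm by (intro Bochner_Integration.integrable_bound[OF ieD] AE_I2 order_trans[OF bd]) auto
    have ic: "integrable lborel (\<lambda>x. c (exp (- x)) * ?D x)"
      using Bochner_Integration.integrable_add[OF id ip] by simp
    have "(LINT x|lborel. c (exp (- x)) * ?D x) = (LINT x|lborel. c (exp (- x)) * ?D x - p (exp (- x)) * ?D x)"
      using p0 ic ip by simp
    moreover have "\<bar>LINT x|lborel. c (exp (- x)) * ?D x - p (exp (- x)) * ?D x\<bar> \<le> (LINT x|lborel. e * \<bar>?D x\<bar>)"
      by (intro integral_abs_bound_integral id ieD) (use bd in \<open>unfold real_norm_def\<close>)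
    moreover have "(LINT x|lborel. e * \<bar>?D x\<bar>) = e * M" unfolding M_def by (rule integral_mult_right_zero)
    ultimately show ?thesis by linarith
  qed
  hence "\<bar>LINT x|lborel. c (exp (- x)) * ?D x\<bar> \<le> 0"
  proof -
    assume *: "\<And>e. e > 0 \<Longrightarrow> \<bar>LINT x|lborel. c (exp (- x)) * ?D x\<bar> \<le> e * M"
    have M: "M \<ge> 0" unfolding M_def by simp
    show ?thesis
    proof (rule field_le_epsilon)
      fix e :: real assume "e > 0"
      \<comment> \<open>Dividing by \<open>M + 1\<close> rather than \<open>M\<close> covers the
        case \<open>M = 0\<close>.\<close>
      hence "\<bar>LINT x|lborel. c (exp (- x)) * ?D x\<bar> \<le> e / (M + 1) * M" using M by (intro *) auto
      also have "\<dots> \<le> e" using M \<open>e > 0\<close> by (simp add: field_simps)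
      finally show "\<bar>LINT x|lborel. c (exp (- x)) * ?D x\<bar> \<le> 0 + e" by simp
    qed
  qed
  thus ?thesis unfolding set_lebesgue_integral_def by (simp add: mult_ac)
qed

text \<open>
  The test function is \<open>e\<^sup>-\<^sup>x c(e\<^sup>-\<^sup>x)\<close> with \<open>c\<close> a bump around \<open>e\<^sup>-\<^sup>y\<close>; it would give a positive integral if \<open>d y > 0\<close>.
\<close>

lemma Laplace_transform_zero_nonpos:
  fixes d :: "real \<Rightarrow> real"
  assumes int: "set_integrable lborel {0<..} (\<lambda>x. exp (- x) * d x)"
    and zero: "\<And>n::nat. (LBINT x:{0<..}. exp (- real (Suc n) * x) * d x) = 0"
    and cont: "continuous_on {0<..} d" and "y > 0"
  shows "d y \<le> 0"
proof (rule ccontr)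
  assume "\<not> d y \<le> 0"
  hence dy: "d y > 0" by simp
  have "isCont d y" using cont \<open>y > 0\<close> by (auto simp: continuous_on_eq_continuous_at)
  hence "(d \<longlongrightarrow> d y) (nhds y)"
    by (simp add: continuous_at tendsto_nhds_iff)
  hence "eventually (\<lambda>x. d x > 0) (nhds y)"
    using dy by (rule order_tendstoD(1))
  then obtain e0 where e0: "e0 > 0" "\<And>x. \<bar>x - y\<bar> < e0 \<Longrightarrow> d x > 0"
    unfolding eventually_nhds_metric dist_real_def by blast
  \<comment> \<open>The minimum with \<open>y\<close> keeps (y - e, y + e) inside the positive half
    line.\<close>
  define e where "e = min e0 y"
  have e: "e > 0" "\<And>x. \<bar>x - y\<bar> < e \<Longrightarrow> d x > 0" "e \<le> y" using e0 \<open>y > 0\<close> by (auto simp: e_def)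
  \<comment> \<open>The product of the signed distances to the images of the two endpoints, cut off
    at 0: continuous, and positive at exp (- x) precisely for |x - y| < e.\<close>
  define c where "c u = max 0 ((u - exp (- (y + e))) * (exp (- (y - e)) - u))" for u :: real
  have cpos: "c (exp (- x)) > 0" if "\<bar>x - y\<bar> < e" for x
    using that by (auto simp: c_def less_max_iff_disj intro!: mult_pos_pos)
  have czero: "c (exp (- x)) = 0" if "\<not> \<bar>x - y\<bar> < e" for x
  proof -
    have "exp (- x) \<le> exp (- (y + e)) \<or> exp (- x) \<ge> exp (- (y - e))" using that by auto
    moreover have "exp (- (y + e)) \<le> exp (- (y - e))" using e by simp
    ultimately have "(exp (- x) - exp (- (y + e))) * (exp (- (y - e)) - exp (- x)) \<le> 0"
      by (smt (verit) mult_nonneg_nonpos mult_nonpos_nonneg)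
    thus ?thesis by (simp add: c_def)
  qed
  have cc: "continuous_on S c" for S unfolding c_def by (intro continuous_intros)
  let ?F = "\<lambda>x. indicator {0<..} x * (c (exp (- x)) * (exp (- x) * d x))"
  have F0: "(LINT x|lborel. ?F x) = 0"
    using Laplace_transform_zero[OF int zero cc]
    by (simp add: set_lebesgue_integral_def)
  have Fnn: "?F x \<ge> 0" for x
    using cpos[of x] czero[of x] e(2)[of x] by (cases "\<bar>x - y\<bar> < e") (auto simp: indicator_def)
  have Fi: "integrable lborel ?F"
  proof (rule Bochner_Integration.integrable_bound)
    show "integrable lborel (\<lambda>x. (exp (- (y - e)))\<^sup>2 * (indicator {0<..} x * (exp (- x) * d x)))"
      using int by (auto simp: set_integrable_def)
    have "(\<lambda>x. c (exp (- x)) * (indicator {0<..} x * (exp (- x) * d x))) \<in> borel_measurable lborel"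
      using int unfolding set_integrable_def c_def by (auto dest!: borel_measurable_integrable)
    thus "?F \<in> borel_measurable lborel" by (simp add: mult_ac)
    have "c (exp (- x)) \<le> (exp (- (y - e)))\<^sup>2" for x
    proof (cases "\<bar>x - y\<bar> < e")
      case True
      hence "exp (- x) \<le> exp (- (y - e))" "exp (- x) \<ge> exp (- (y + e))" by auto
      hence "(exp (- x) - exp (- (y + e))) * (exp (- (y - e)) - exp (- x)) \<le> exp (- (y - e)) * exp (- (y - e))"
        using exp_gt_zero[of "- (y + e)"] exp_gt_zero[of "- x"]
        by (intro mult_mono) linarith+
      thus ?thesis by (simp add: c_def power2_eq_square)
    qed (simp add: czero)
    moreover have "c u \<ge> 0" for u by (simp add: c_def)
    ultimately show "AE x in lborel. norm (?F x) \<le>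
        norm ((exp (- (y - e)))\<^sup>2 * (indicator {0<..} x * (exp (- x) * d x)))"
      by (auto simp: abs_mult indicator_def intro!: mult_right_mono)
  qed
  have "AE x in lborel. ?F x = 0"
    using integral_nonneg_eq_0_iff_AE[OF Fi] F0 Fnn by simp
  then obtain x where "x \<in> {y - e<..<y + e}" "?F x = 0"
    using AE_lborel_interval_ex[of _ "y - e" "y + e"] e(1) by fastforce
  moreover have "\<bar>x - y\<bar> < e" "x > 0" using \<open>x \<in> _\<close> e by auto
  ultimately show False using cpos[of x] e(2)[of x] by simp
qed

section \<open>Levy tails\<close>

lemma antimono_on_borel_measurable:
  fixes h :: "real \<Rightarrow> real"
  assumes "antimono_on {0<..} h"
  shows "(\<lambda>x. indicator {0<..} x * h x) \<in> borel_measurable borel"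
proof -
  have "mono_on {0<..} (\<lambda>x. - h x)"
    using assms by (auto simp: monotone_on_def)
  hence "(\<lambda>x. - h x) \<in> borel_measurable (restrict_space borel {0<..})"
    by (rule borel_measurable_mono_on_fnc)
  hence "(\<lambda>x. - (- h x)) \<in> borel_measurable (restrict_space borel {0<..})"
    by (rule borel_measurable_uminus)
  thus ?thesis
    by (subst (asm) borel_measurable_restrict_space_iff) auto
qed

locale levy_measure =
  fixes \<nu> :: "real measure"
  assumes sets_levy: "sets \<nu> = sets (restrict_space borel {0<..})"
    and min_finite: "(\<integral>\<^sup>+ t. ennreal (min 1 t) \<partial>\<nu>) < \<infinity>"
begin

lemma space_levy: "space \<nu> = {0<..}"
  using sets_eq_imp_space_eq[OF sets_levy] by (simp add: space_restrict_space)

lemma Ioi_sets: "x \<ge> 0 \<Longrightarrow> {x<..} \<in> sets \<nu>"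
  unfolding sets_levy by (subst sets_restrict_space_iff) auto

lemma ident_measurable [measurable]: "(\<lambda>t. t) \<in> borel_measurable \<nu>"
  by (subst measurable_cong_sets[OF sets_levy refl]) (intro measurable_restrict_space1 measurable_ident[unfolded id_def])

lemma emeasure_tail_finite:
  assumes "x > 0"
  shows "emeasure \<nu> {x<..} < \<infinity>"
proof -
  have "ennreal (min 1 x) * emeasure \<nu> {x<..} = (\<integral>\<^sup>+ t. ennreal (min 1 x) * indicator {x<..} t \<partial>\<nu>)"
    using Ioi_sets assms by (subst nn_integral_cmult_indicator) auto
  also have "\<dots> \<le> (\<integral>\<^sup>+ t. ennreal (min 1 t) \<partial>\<nu>)"
    by (intro nn_integral_mono) (auto simp: indicator_def intro!: ennreal_leI)
  also note min_finite
  finally show ?thesis using assms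
    by (auto simp: ennreal_mult_less_top)
qed

lemma emeasure_eq_tail: "x > 0 \<Longrightarrow> emeasure \<nu> {x<..} = ennreal (levy_tail \<nu> x)"
  unfolding levy_tail_def using emeasure_tail_finite[of x]
  by (intro emeasure_eq_ennreal_measure) auto

lemma levy_tail_nonneg: "levy_tail \<nu> x \<ge> 0"
  by (simp add: levy_tail_def)

lemma levy_tail_antimono: "antimono_on {0<..} (levy_tail \<nu>)"
proof (rule monotone_onI)
  fix x y :: real assume xy: "x \<in> {0<..}" "y \<in> {0<..}" "x \<le> y"
  have "emeasure \<nu> {y<..} \<le> emeasure \<nu> {x<..}"
    using xy Ioi_sets by (intro emeasure_mono) auto
  thus "levy_tail \<nu> y \<le> levy_tail \<nu> x"
    using xy by (simp add: emeasure_eq_tail levy_tail_nonneg)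
qed

text \<open>Needed for Fubini, since the total mass may be infinite near 0. The half lines starting
  at 1 / (n + 1) have finite mass and exhaust (0, \<infinity>).\<close>

lemma sigma_finite_levy: "sigma_finite_measure \<nu>"
proof
  let ?A = "range (\<lambda>n. {inverse (real (Suc n))<..})"
  have "\<Union>?A = {0<..}"
  proof -
    have "\<exists>n. inverse (real (Suc n)) < x" if "x > 0" for x :: real
      using reals_Archimedean[OF that] by auto
    moreover have "x > 0" if "inverse (real (Suc n)) < x" for x n
      using that by (rule less_trans[rotated]) simp
    ultimately show ?thesis by (auto simp del: of_nat_Suc)
  qed
  thus "\<exists>A. countable A \<and> A \<subseteq> sets \<nu> \<and> \<Union>A = space \<nu> \<and> (\<forall>a\<in>A. emeasure \<nu> a \<noteq> \<infinity>)"
    using emeasure_tail_finite Ioi_sets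
    by (intro exI[of _ ?A]) (auto simp: space_levy less_top[symmetric] simp del: of_nat_Suc)
qed

text \<open>The integrand is at most l t for small t and at most 1 for large t, hence at most max 1
  l times min 1 t.\<close>

lemma one_minus_exp_integrable:
  assumes l: "l > (0::real)"
  shows "integrable \<nu> (\<lambda>t. 1 - exp (- l * t))"
proof (rule integrableI_bounded)
  have bd: "norm (1 - exp (- l * t)) \<le> max 1 l * min 1 t" if "t > 0" for t
  proof -
    have 1: "0 \<le> 1 - exp (- l * t)" using l that by simp
    have 2: "1 - exp (- l * t) \<le> l * t" using exp_ge_add_one_self[of "- l * t"] by simp
    have "1 - exp (- l * t) \<le> 1" by simp
    show ?thesis
    proof (cases "t \<le> 1")
      case True
      have "l * t \<le> max 1 l * t" using that by (intro mult_right_mono) auto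
      with 1 2 True show ?thesis by (simp add: min_def)
    next
      case False
      with 1 show ?thesis by (auto simp: min_def max_def; smt (verit) exp_gt_zero)
    qed
  qed
  have "(\<integral>\<^sup>+ t. ennreal (norm (1 - exp (- l * t))) \<partial>\<nu>) \<le> (\<integral>\<^sup>+ t. ennreal (max 1 l) * ennreal (min 1 t) \<partial>\<nu>)"
    by (intro nn_integral_mono)
      (use bd in \<open>auto simp: space_levy ennreal_mult[symmetric] intro!: ennreal_leI\<close>)
  also have "\<dots> = ennreal (max 1 l) * (\<integral>\<^sup>+ t. ennreal (min 1 t) \<partial>\<nu>)"
    by (intro nn_integral_cmult) measurable
  also have "\<dots> < \<infinity>" using min_finite by (auto simp: ennreal_mult_less_top)
  finally show "(\<integral>\<^sup>+ t. ennreal (norm (1 - exp (- l * t))) \<partial>\<nu>) < \<infinity>" .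
qed measurable

lemma one_minus_exp_integral_nonneg:
  assumes l: "l > (0::real)"
  shows "(\<integral> t. (1 - exp (- l * t)) \<partial>\<nu>) \<ge> 0"
  using l by (intro Bochner_Integration.integral_nonneg) (auto simp: space_levy)

text \<open>Tonelli on the region 0 < x < t: integrating exp (- l x) over x in (0, t) leaves (1 -
  exp (- l t)) / l. The nonnegative integral is used so that finiteness of the transform, and with
  it local integrability of the tail, is part of the conclusion.\<close>

lemma Laplace_levy_tail:
  assumes l: "l > (0::real)"
  shows "(\<integral>\<^sup>+ x. indicator {0<..} x * ennreal (exp (- l * x) * levy_tail \<nu> x) \<partial>lborel)
     = ennreal ((\<integral> t. (1 - exp (- l * t)) \<partial>\<nu>) / l)"
proof -
  interpret S: sigma_finite_measure \<nu> by (rule sigma_finite_levy)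
  interpret P: pair_sigma_finite lborel \<nu> ..
  define F where "F = (\<lambda>(x, t). if 0 < x \<and> x < t then ennreal (exp (- l * x)) else 0)"
  have Fm [measurable]: "F \<in> borel_measurable (lborel \<Otimes>\<^sub>M \<nu>)"
    unfolding F_def by measurable
  have 1: "indicator {0<..} x * ennreal (exp (- l * x) * levy_tail \<nu> x) = (\<integral>\<^sup>+ t. F (x, t) \<partial>\<nu>)" for x
  proof (cases "x > 0")
    case True
    have "(\<integral>\<^sup>+ t. F (x, t) \<partial>\<nu>) = (\<integral>\<^sup>+ t. ennreal (exp (- l * x)) * indicator {x<..} t \<partial>\<nu>)"
      using True by (intro nn_integral_cong) (auto simp: F_def indicator_def)
    also have "\<dots> = ennreal (exp (- l * x)) * emeasure \<nu> {x<..}"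
      using True Ioi_sets by (intro nn_integral_cmult_indicator) auto
    finally show ?thesis
      using True by (simp add: emeasure_eq_tail ennreal_mult levy_tail_nonneg)
  qed (simp add: F_def)
  have 2: "(\<integral>\<^sup>+ x. F (x, t) \<partial>lborel) = ennreal ((1 - exp (- l * t)) / l)" if "t > 0" for t
  proof -
    have "(\<integral>\<^sup>+ x. F (x, t) \<partial>lborel) = (\<integral>\<^sup>+ x. ennreal (exp (- l * x)) * indicator {0..t} x \<partial>lborel)"
    proof (rule nn_integral_cong_AE)
      have "AE x in lborel. x \<noteq> 0 \<and> x \<noteq> t"
        using AE_lborel_singleton[of 0] AE_lborel_singleton[of t] by eventually_elim auto
      thus "AE x in lborel. F (x, t) = ennreal (exp (- l * x)) * indicator {0..t} x"
        by eventually_elim (auto simp: F_def indicator_def)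
    qed
    also have "\<dots> = ennreal ((- exp (- l * t) / l) - (- exp (- l * 0) / l))"
      using l that by (intro nn_integral_FTC_Icc) (auto intro!: derivative_eq_intros)
    finally show ?thesis using l by (simp add: field_simps)
  qed
  have "(\<integral>\<^sup>+ x. indicator {0<..} x * ennreal (exp (- l * x) * levy_tail \<nu> x) \<partial>lborel)
     = (\<integral>\<^sup>+ x. (\<integral>\<^sup>+ t. F (x, t) \<partial>\<nu>) \<partial>lborel)"
    by (simp only: 1)
  also have "\<dots> = (\<integral>\<^sup>+ t. (\<integral>\<^sup>+ x. F (x, t) \<partial>lborel) \<partial>\<nu>)"
    by (rule P.Fubini[OF Fm, symmetric])
  also have "\<dots> = (\<integral>\<^sup>+ t. ennreal ((1 - exp (- l * t)) / l) \<partial>\<nu>)"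
    by (intro nn_integral_cong 2) (simp add: space_levy)
  also have "\<dots> = ennreal (\<integral> t. (1 - exp (- l * t)) / l \<partial>\<nu>)"
    using l by (intro nn_integral_eq_integral integrable_divide one_minus_exp_integrable)
      (auto simp: space_levy)
  finally show ?thesis by simp
qed

end

section \<open>Levy measures with a decreasing density\<close>

lemma emeasure_density_halfline:
  fixes m :: "real \<Rightarrow> real"
  assumes \<mu>: "\<mu> = density (restrict_space lborel {0<..}) (\<lambda>t. ennreal (m t))"
    and anti: "antimono_on {0<..} m" and S: "S \<in> sets \<mu>"
  shows "emeasure \<mu> S = (\<integral>\<^sup>+ t. ennreal (m t) * indicator S t * indicator {0<..} t \<partial>lborel)"
proof -
  have mm: "(\<lambda>t. ennreal (m t)) \<in> borel_measurable (restrict_space lborel {0<..})"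
  proof (rule measurable_compose[OF _ measurable_ennreal])
    have "(\<lambda>x. indicator {0<..} x *\<^sub>R m x) \<in> borel_measurable lborel"
      using antimono_on_borel_measurable[OF anti] by simp
    thus "m \<in> borel_measurable (restrict_space lborel {0<..})"
      by (subst borel_measurable_restrict_space_iff) auto
  qed
  have "emeasure \<mu> S = (\<integral>\<^sup>+ t. ennreal (m t) * indicator S t \<partial>restrict_space lborel {0<..})"
    using S by (subst \<mu>, subst emeasure_density[OF mm]) (auto simp: \<mu>)
  also have "\<dots> = (\<integral>\<^sup>+ t. ennreal (m t) * indicator S t * indicator {0<..} t \<partial>lborel)"
    by (subst nn_integral_restrict_space) auto
  finally show ?thesis .
qed

text \<open>The difference of the tails is the mass of (y, x], where a decreasing density lies
  between its end values. The upper bound serves for continuity of the tail, the lower one for its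
  strict decrease.\<close>

lemma levy_tail_density_bounds:
  fixes m :: "real \<Rightarrow> real"
  assumes \<mu>: "\<mu> = density (restrict_space lborel {0<..}) (\<lambda>t. ennreal (m t))"
    and levy: "levy_measure \<mu>" and anti: "antimono_on {0<..} m" and nn: "\<And>t. t > 0 \<Longrightarrow> m t \<ge> 0"
    and xy: "0 < y" "y \<le> x"
  shows "levy_tail \<mu> y - levy_tail \<mu> x \<le> m y * (x - y)"
    and "m x * (x - y) \<le> levy_tail \<mu> y - levy_tail \<mu> x"
proof -
  interpret levy_measure \<mu> by (rule levy)
  have yx: "{y<..x} \<in> sets \<mu>"
    unfolding sets_levy using xy by (subst sets_restrict_space_iff) auto
  have "ennreal (levy_tail \<mu> y) = emeasure \<mu> ({y<..x} \<union> {x<..})"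
    using xy by (simp add: emeasure_eq_tail[symmetric] ivl_disj_un)
  also have "\<dots> = emeasure \<mu> {y<..x} + emeasure \<mu> {x<..}"
    using yx Ioi_sets[of x] xy by (intro plus_emeasure[symmetric]) auto
  finally have A: "ennreal (levy_tail \<mu> y) = emeasure \<mu> {y<..x} + ennreal (levy_tail \<mu> x)"
    using xy by (simp add: emeasure_eq_tail)
  note E = emeasure_density_halfline[OF \<mu> anti yx]
  have m: "m t \<le> m y" "m x \<le> m t" if "t \<in> {y<..x}" for t
    using that xy by (auto intro!: monotone_onD[OF anti])
  have C: "(\<integral>\<^sup>+ t. ennreal c * indicator {y<..x} t \<partial>lborel) = ennreal (c * (x - y))" if "c \<ge> 0" for c
    using xy that by (subst nn_integral_cmult_indicator) (auto simp: ennreal_mult)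
  have "emeasure \<mu> {y<..x} \<le> (\<integral>\<^sup>+ t. ennreal (m y) * indicator {y<..x} t \<partial>lborel)"
    unfolding E by (intro nn_integral_mono) (auto simp: indicator_def intro!: ennreal_leI m)
  hence "ennreal (levy_tail \<mu> y) \<le> ennreal (m y * (x - y) + levy_tail \<mu> x)"
    unfolding A using C[of "m y"] nn[of y] xy levy_tail_nonneg
    by (subst ennreal_plus) (auto intro!: add_right_mono)
  thus "levy_tail \<mu> y - levy_tail \<mu> x \<le> m y * (x - y)"
    using nn[of y] xy levy_tail_nonneg[of x]
    by (subst (asm) ennreal_le_iff) (auto intro!: add_nonneg_nonneg mult_nonneg_nonneg)
  have "(\<integral>\<^sup>+ t. ennreal (m x) * indicator {y<..x} t \<partial>lborel) \<le> emeasure \<mu> {y<..x}"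
    unfolding E using xy by (intro nn_integral_mono) (auto simp: indicator_def intro!: ennreal_leI m)
  hence "ennreal (m x * (x - y) + levy_tail \<mu> x) \<le> ennreal (levy_tail \<mu> y)"
    unfolding A using C[of "m x"] nn[of x] xy levy_tail_nonneg
    by (subst ennreal_plus) (auto intro!: add_right_mono)
  thus "m x * (x - y) \<le> levy_tail \<mu> y - levy_tail \<mu> x"
    using levy_tail_nonneg by (subst (asm) ennreal_le_iff) (auto simp: algebra_simps)
qed

lemma levy_tail_density_eq_0:
  fixes m :: "real \<Rightarrow> real"
  assumes \<mu>: "\<mu> = density (restrict_space lborel {0<..}) (\<lambda>t. ennreal (m t))"
    and levy: "levy_measure \<mu>" and anti: "antimono_on {0<..} m" and nn: "\<And>t. t > 0 \<Longrightarrow> m t \<ge> 0"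
    and yx: "0 < y" "y < x" and eq: "levy_tail \<mu> y = levy_tail \<mu> x"
  shows "levy_tail \<mu> x = 0"
proof -
  interpret levy_measure \<mu> by (rule levy)
  have "m x * (x - y) \<le> 0"
    using levy_tail_density_bounds(2)[OF \<mu> levy anti nn, of y x] yx eq by simp
  hence "m x = 0" using yx nn[of x] by (auto simp: mult_le_0_iff)
  hence z: "ennreal (m t) * indicator {x<..} t * indicator {0<..} t = 0" for t
    using monotone_onD[OF anti, of x t] nn[of t] yx by (cases "t > x") auto
  have "x \<ge> 0" using yx by simp
  hence "emeasure \<mu> {x<..} = 0"
    unfolding emeasure_density_halfline[OF \<mu> anti Ioi_sets[OF \<open>x \<ge> 0\<close>]] z by simp
  thus ?thesis using emeasure_eq_tail[of x] yx levy_tail_nonneg[of x] by simp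
qed

text \<open>On [x / 2, \<infinity>) the density is at most m (x / 2), so the tail is Lipschitz
  there; halving x leaves room on both sides of x and stays away from the possible singularity at
  0.\<close>

lemma continuous_on_levy_tail_density:
  fixes m :: "real \<Rightarrow> real"
  assumes \<mu>: "\<mu> = density (restrict_space lborel {0<..}) (\<lambda>t. ennreal (m t))"
    and levy: "levy_measure \<mu>" and anti: "antimono_on {0<..} m" and nn: "\<And>t. t > 0 \<Longrightarrow> m t \<ge> 0"
  shows "continuous_on {0<..} (levy_tail \<mu>)"
proof (rule continuous_at_imp_continuous_on, rule ballI)
  fix x :: real assume "x \<in> {0<..}"
  hence x: "x > 0" by simp
  let ?C = "m (x / 2)"
  have bd: "\<bar>levy_tail \<mu> y - levy_tail \<mu> x\<bar> \<le> ?C * \<bar>y - x\<bar>" if y: "y > x / 2" for y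
  proof -
    have *: "\<bar>levy_tail \<mu> s - levy_tail \<mu> t\<bar> \<le> ?C * (t - s)" if "x / 2 \<le> s" "s \<le> t" for s t
    proof -
      have "levy_tail \<mu> s - levy_tail \<mu> t \<le> m s * (t - s)" "m t * (t - s) \<le> levy_tail \<mu> s - levy_tail \<mu> t"
        using levy_tail_density_bounds[OF \<mu> levy anti nn, of s t] that x by auto
      moreover have "m s * (t - s) \<le> ?C * (t - s)"
        using that x by (intro mult_right_mono monotone_onD[OF anti]) auto
      moreover have "m t * (t - s) \<ge> 0" using nn[of t] that x by simp
      ultimately show ?thesis by linarith
    qed
    show ?thesis
      using *[of x y] *[of y x] y x by (cases "x \<le> y") (auto simp: abs_minus_commute)
  qed
  have "((\<lambda>y. levy_tail \<mu> y - levy_tail \<mu> x) \<longlongrightarrow> 0) (at x)"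
  proof (rule Lim_null_comparison)
    have "eventually (\<lambda>y. y > x / 2) (at x)"
      using x by (intro order_tendstoD(1)[OF tendsto_ident_at]) auto
    thus "eventually (\<lambda>y. norm (levy_tail \<mu> y - levy_tail \<mu> x) \<le> ?C * \<bar>y - x\<bar>) (at x)"
      by eventually_elim (use bd in simp)
    have "((\<lambda>y. ?C * \<bar>y - x\<bar>) \<longlongrightarrow> ?C * \<bar>x - x\<bar>) (at x)" by (intro tendsto_intros)
    thus "((\<lambda>y. ?C * \<bar>y - x\<bar>) \<longlongrightarrow> 0) (at x)" by simp
  qed
  thus "isCont (levy_tail \<mu>) x" unfolding isCont_def by (rule LIM_zero_cancel)
qed

lemma completely_monotone_nonneg: "completely_monotone m \<Longrightarrow> x > 0 \<Longrightarrow> m x \<ge> 0"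
  unfolding completely_monotone_def by (erule allE[of _ 0]) simp

lemma completely_monotone_antimono:
  assumes "completely_monotone m"
  shows "antimono_on {0<..} m"
proof (rule monotone_onI)
  fix x y :: real assume xy: "x \<in> {0<..}" "y \<in> {0<..}" "x \<le> y"
  have d: "m field_differentiable (at t)" "deriv m t \<le> 0" if "t > 0" for t
    using assms[unfolded completely_monotone_def, rule_format, OF that, of 0]
      assms[unfolded completely_monotone_def, rule_format, OF that, of 1] by auto
  show "m y \<le> m x"
  proof (rule DERIV_nonpos_imp_nonincreasing[OF xy(3)])
    fix t assume "x \<le> t" "t \<le> y"
    hence "t > 0" using xy by auto
    thus "\<exists>z. (m has_real_derivative z) (at t) \<and> z \<le> 0"
      using d[of t] by (auto intro!: exI[of _ "deriv m t"] simp: field_differentiable_derivI)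
  qed
qed

section \<open>The Sonine identity\<close>

text \<open>Extension by 0 to the left adds at most a discontinuity at 0 to the countably many of a
  monotone function. This allows limits under a convolution integral for kernels known only to be
  monotone: the integrand can fail to converge only on a null set.\<close>

lemma countable_discontinuities_antimono:
  fixes h :: "real \<Rightarrow> real"
  assumes "antimono_on {0<..} h"
  shows "countable {x. \<not> isCont (\<lambda>x. indicator {0<..} x * h x) x}"
proof -
  let ?h = "\<lambda>x. indicator {0<..} x * h x"
  have "mono_on {0<..} (\<lambda>x. - h x)"
    using assms by (auto simp: monotone_on_def)
  hence "countable {a \<in> {0<..}. \<not> isCont (\<lambda>x. - h x) a}"
    by (rule mono_on_ctble_discont_open[rotated]) simp
  moreover have "{x. \<not> isCont ?h x} \<subseteq> insert 0 {a \<in> {0<..}. \<not> isCont (\<lambda>x. - h x) a}"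
  proof
    fix x assume x: "x \<in> {x. \<not> isCont ?h x}"
    have "isCont ?h x" if "x < 0"
    proof -
      have "eventually (\<lambda>y. y < 0) (nhds x)"
        using that by (intro eventually_nhds_in_open[of "{..<0}", simplified]) auto
      hence "eventually (\<lambda>y. ?h y = 0) (nhds x)" by eventually_elim auto
      thus ?thesis by (subst isCont_cong[where g = "\<lambda>_. 0"]) auto
    qed
    moreover have "isCont ?h x" if "x > 0" "isCont (\<lambda>x. - h x) x"
    proof -
      have "eventually (\<lambda>y. y > 0) (nhds x)"
        using that by (intro eventually_nhds_in_open[of "{0<..}", simplified]) auto
      hence "eventually (\<lambda>y. ?h y = - (- h y)) (nhds x)" by eventually_elim auto
      moreover have "isCont (\<lambda>x. - (- h x)) x" using that(2) by (rule continuous_minus)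
      ultimately show ?thesis by (subst isCont_cong) auto
    qed
    ultimately show "x \<in> insert 0 {a \<in> {0<..}. \<not> isCont (\<lambda>x. - h x) a}"
      using x by (cases x "0::real" rule: linorder_cases) auto
  qed
  ultimately show ?thesis by (meson countable_insert countable_subset)
qed

lemma nn_integral_exp_Ioi:
  assumes "l > (0::real)"
  shows "(\<integral>\<^sup>+ x. ennreal (indicator {0<..} x * exp (- l * x)) \<partial>lborel) = ennreal (1 / l)"
proof -
  have "(\<integral>\<^sup>+ x. ennreal (indicator {0<..} x * exp (- l * x)) \<partial>lborel)
      = (\<integral>\<^sup>+ x. ennreal (exp (- l * x)) * indicator {0..} x \<partial>lborel)"
  proof (rule nn_integral_cong_AE)
    show "AE x in lborel. ennreal (indicator {0<..} x * exp (- l * x)) = ennreal (exp (- l * x)) * indicator {0..} x"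
      using AE_lborel_singleton[of 0] by eventually_elim (auto simp: indicator_def)
  qed
  also have "\<dots> = ennreal (0 - (- exp (- l * 0) / l))"
  proof (rule nn_integral_FTC_atLeast)
    have "LIM x at_top. - l * x :> at_bot"
      using assms by (intro filterlim_tendsto_neg_mult_at_bot[OF tendsto_const _ filterlim_ident]) auto
    hence "((\<lambda>x. exp (- l * x)) \<longlongrightarrow> 0) at_top"
      by (rule filterlim_compose[OF exp_at_bot])
    hence "((\<lambda>x. - exp (- l * x) / l) \<longlongrightarrow> - 0 / l) at_top"
      using assms by (intro tendsto_intros) auto
    thus "((\<lambda>x. - exp (- l * x) / l) \<longlongrightarrow> 0) at_top" by simp
  qed (use assms in \<open>auto intro!: derivative_eq_intros\<close>)
  finally show ?thesis by simp
qed

text \<open>By Tonelli the transform of the convolution is the product of the transforms, here 1 /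
  l, which is also the transform of the constant 1. Most of the proof upgrades the convolution to a
  finite continuous function, so that the comparison with 1 holds at each x.\<close>

lemma Sonine_from_Laplace:
  fixes A k :: "real \<Rightarrow> real"
  assumes A: "antimono_on {0<..} A" "\<And>x. x > 0 \<Longrightarrow> A x \<ge> 0"
    and k: "antimono_on {0<..} k" "\<And>x. x > 0 \<Longrightarrow> k x \<ge> 0"
    and L: "\<And>l. l > 0 \<Longrightarrow>
       (\<integral>\<^sup>+ x. indicator {0<..} x * ennreal (exp (- l * x) * A x) \<partial>lborel) *
       (\<integral>\<^sup>+ x. indicator {0<..} x * ennreal (exp (- l * x) * k x) \<partial>lborel) = ennreal (1 / l)"
    and "x > 0"
  shows "has_bochner_integral lborel (\<lambda>t. indicator {0<..<x} t * (A (x - t) * k t)) 1"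
proof -
  define A' where "A' = (\<lambda>x. indicator {0<..} x * A x)"
  define k' where "k' = (\<lambda>x. indicator {0<..} x * k x)"
  have [measurable]: "A' \<in> borel_measurable borel" "k' \<in> borel_measurable borel"
    unfolding A'_def k'_def using A k by (auto intro!: antimono_on_borel_measurable)
  have nn: "A' x \<ge> 0" "k' x \<ge> 0" for x
    using A(2)[of x] k(2)[of x] by (auto simp: A'_def k'_def indicator_def)
  define H where "H = (\<lambda>x. \<integral>\<^sup>+ t. ennreal (A' (x - t) * k' t) \<partial>lborel)"
  have [measurable]: "H \<in> borel_measurable borel" unfolding H_def by measurable
  have LH: "(\<integral>\<^sup>+ x. ennreal (exp (- l * x)) * H x \<partial>lborel) = ennreal (1 / l)" if l: "l > 0" for l
  proof -
    let ?LA = "\<integral>\<^sup>+ x. ennreal (exp (- l * x) * A' x) \<partial>lborel"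
    have "(\<integral>\<^sup>+ x. ennreal (exp (- l * x)) * H x \<partial>lborel)
        = (\<integral>\<^sup>+ x. \<integral>\<^sup>+ t. ennreal (exp (- l * x) * (A' (x - t) * k' t)) \<partial>lborel \<partial>lborel)"
      unfolding H_def by (subst nn_integral_cmult[symmetric]) (auto simp: ennreal_mult nn)
    also have "\<dots> = (\<integral>\<^sup>+ t. \<integral>\<^sup>+ x. ennreal (exp (- l * x) * (A' (x - t) * k' t)) \<partial>lborel \<partial>lborel)"
      by (rule lborel_pair.Fubini'[symmetric]) measurable
    also have "\<dots> = (\<integral>\<^sup>+ t. ennreal (exp (- l * t) * k' t) * ?LA \<partial>lborel)"
    proof (rule nn_integral_cong)
      fix t :: real
      have "(\<integral>\<^sup>+ x. ennreal (exp (- l * x) * (A' (x - t) * k' t)) \<partial>lborel)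
         = (\<integral>\<^sup>+ x. ennreal (exp (- l * (t + x)) * (A' x * k' t)) \<partial>lborel)"
        by (subst nn_integral_real_affine[where c = 1 and t = t]) auto
      also have "\<dots> = (\<integral>\<^sup>+ x. ennreal (exp (- l * t) * k' t) * ennreal (exp (- l * x) * A' x) \<partial>lborel)"
        by (intro nn_integral_cong)
          (simp add: ennreal_mult[symmetric] nn exp_add[symmetric] algebra_simps exp_diff exp_minus mult_exp_exp divide_simps)
      also have "\<dots> = ennreal (exp (- l * t) * k' t) * ?LA"
        by (rule nn_integral_cmult) measurable
      finally show "(\<integral>\<^sup>+ x. ennreal (exp (- l * x) * (A' (x - t) * k' t)) \<partial>lborel) = \<dots>" .
    qed
    also have "\<dots> = (\<integral>\<^sup>+ t. ennreal (exp (- l * t) * k' t) \<partial>lborel) * ?LA"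
      by (rule nn_integral_multc) measurable
    also have "?LA = (\<integral>\<^sup>+ x. indicator {0<..} x * ennreal (exp (- l * x) * A x) \<partial>lborel)"
      by (intro nn_integral_cong) (auto simp: A'_def indicator_def)
    also have "(\<integral>\<^sup>+ t. ennreal (exp (- l * t) * k' t) \<partial>lborel)
        = (\<integral>\<^sup>+ x. indicator {0<..} x * ennreal (exp (- l * x) * k x) \<partial>lborel)"
      by (intro nn_integral_cong) (auto simp: k'_def indicator_def)
    finally show ?thesis using L[OF l] by (simp add: mult.commute)
  qed
  \<comment> \<open>Rescaling to \<open>(0, 1)\<close> makes the integrand antimonotone in \<open>x\<close>, hence dominated near each \<open>x > 0\<close>.\<close>
  define G where "G = (\<lambda>x. \<integral>\<^sup>+ s. ennreal (A' (x * (1 - s)) * k' (x * s)) \<partial>lborel)"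
  have HG: "H x = ennreal x * G x" if "x > 0" for x
    unfolding H_def G_def using that
    by (subst nn_integral_real_affine[where c = x and t = 0]) (auto simp: algebra_simps)
  have anti: "A' (y * (1 - s)) * k' (y * s) \<le> A' (x * (1 - s)) * k' (x * s)" if "0 < x" "x \<le> y" for x y s
  proof (cases "0 < s \<and> s < 1")
    case True
    hence "x * s \<le> y * s" "x * (1 - s) \<le> y * (1 - s)" using that by (auto intro!: mult_right_mono)
    moreover have "x * s > 0" "x * (1 - s) > 0" using that True by auto
    ultimately have "A (y * (1 - s)) \<le> A (x * (1 - s))" "k (y * s) \<le> k (x * s)" "x * s > 0" "x * (1 - s) > 0"
       "y * s > 0" "y * (1 - s) > 0"
      using that by (auto intro!: monotone_onD[OF A(1)] monotone_onD[OF k(1)])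
    thus ?thesis using A(2) k(2) by (auto simp: A'_def k'_def intro!: mult_mono)
  next
    case False
    hence "\<not> y * s > 0 \<or> \<not> y * (1 - s) > 0" using that by (auto simp: zero_less_mult_iff)
    hence "A' (y * (1 - s)) * k' (y * s) = 0" by (auto simp: A'_def k'_def)
    thus ?thesis using nn by (metis mult_nonneg_nonneg)
  qed
  have Gfin: "G x < \<infinity>" if "x > 0" for x
  proof -
    \<comment> \<open>A finite transform makes the convolution finite almost everywhere, hence at
      some \<open>c\<close> below x; since \<open>G\<close> decreases, finiteness passes from
      \<open>c\<close> to x.\<close>
    have "AE y in lborel. ennreal (exp (- 1 * y)) * H y \<noteq> \<infinity>"
      using LH[of 1] by (intro nn_integral_noteq_infinite) auto
    then obtain c where c: "c \<in> {0<..<x}" "ennreal (exp (- 1 * c)) * H c \<noteq> \<infinity>"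
      using AE_lborel_interval_ex \<open>x > 0\<close> by blast
    hence "G c < \<infinity>" by (auto simp: HG ennreal_mult_eq_top_iff less_top)
    moreover have "G x \<le> G c"
      unfolding G_def using c by (intro nn_integral_mono ennreal_leI anti) auto
    ultimately show ?thesis by (rule le_less_trans[rotated])
  qed
  have gint: "integrable lborel (\<lambda>s. A' (x * (1 - s)) * k' (x * s))" if "x > 0" for x
    using Gfin[OF that] nn unfolding G_def by (intro integrableI_nonneg) auto
  define g where "g = (\<lambda>x. LINT s|lborel. A' (x * (1 - s)) * k' (x * s))"
  have Gg: "G x = ennreal (g x)" if "x > 0" for x
    unfolding G_def g_def using gint[OF that] nn by (intro nn_integral_eq_integral) auto
  have g_nn: "g x \<ge> 0" for x unfolding g_def using nn by simp
  have Hg: "H x = ennreal (x * g x)" if "x > 0" for x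
    using that by (simp add: HG Gg ennreal_mult g_nn)
  have gcont: "isCont g x" if x: "x > 0" for x
  proof (rule continuous_at_sequentiallyI)
    fix u :: "nat \<Rightarrow> real" assume u: "u \<longlonglongrightarrow> x"
    \<comment> \<open>Cutting the sequence off at x / 2 gives one dominating function, the integrand
      at x / 2, for all its members; the two sequences agree eventually.\<close>
    define v where "v = (\<lambda>n. max (u n) (x / 2))"
    have v: "v \<longlonglongrightarrow> x"
      using tendsto_max[OF u tendsto_const[of "x / 2"]] x by (simp add: v_def)
    have "(\<lambda>n. g (v n)) \<longlonglongrightarrow> g x"
      unfolding g_def
    proof (rule integral_dominated_convergence)
      show "integrable lborel (\<lambda>s. A' (x / 2 * (1 - s)) * k' (x / 2 * s))"
        using x by (intro gint) auto
      have "norm (A' (v i * (1 - s)) * k' (v i * s)) \<le> A' (x / 2 * (1 - s)) * k' (x / 2 * s)" for i s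
        using anti[of "x / 2" "v i" s] x nn by (simp add: v_def)
      thus "AE s in lborel. norm (A' (v i * (1 - s)) * k' (v i * s)) \<le> A' (x / 2 * (1 - s)) * k' (x / 2 * s)" for i
        by simp
      \<comment> \<open>The exceptional s are those for which x (1 - s) or x s hits a discontinuity
        of the respective kernel: countably many.\<close>
      let ?DA = "{y. \<not> isCont A' y}" and ?Dk = "{y. \<not> isCont k' y}"
      have "countable ((\<lambda>y. 1 - y / x) ` ?DA \<union> (\<lambda>y. y / x) ` ?Dk)"
        unfolding A'_def k'_def
        using countable_discontinuities_antimono A(1) k(1) by (intro countable_Un countable_image) auto
      hence "AE s in lborel. s \<notin> (\<lambda>y. 1 - y / x) ` ?DA \<union> (\<lambda>y. y / x) ` ?Dk"
        by (intro AE_not_in countable_imp_null_set_lborel)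
      thus "AE s in lborel. (\<lambda>i. A' (v i * (1 - s)) * k' (v i * s)) \<longlonglongrightarrow> A' (x * (1 - s)) * k' (x * s)"
      proof eventually_elim
        case (elim s)
        have "s = 1 - (x * (1 - s)) / x" "s = (x * s) / x" using x by auto
        hence "isCont A' (x * (1 - s))" "isCont k' (x * s)" using elim by blast+
        moreover have "(\<lambda>i. v i * (1 - s)) \<longlonglongrightarrow> x * (1 - s)" "(\<lambda>i. v i * s) \<longlonglongrightarrow> x * s"
          using v by (auto intro!: tendsto_intros)
        ultimately show ?case by (intro tendsto_mult) (auto intro: isCont_tendsto_compose)
      qed
    qed measurable
    moreover have "eventually (\<lambda>n. g (v n) = g (u n)) sequentially"
    proof -
      have "eventually (\<lambda>n. u n > x / 2) sequentially"
        using order_tendstoD(1)[OF u, of "x / 2"] x by simp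
      thus ?thesis by eventually_elim (simp add: v_def)
    qed
    ultimately show "(\<lambda>n. g (u n)) \<longlonglongrightarrow> g x" by (rule Lim_transform_eventually)
  qed
  define h where "h = (\<lambda>x. x * g x)"
  have hcont: "continuous_on {0<..} h"
    unfolding h_def using gcont by (intro continuous_intros continuous_at_imp_continuous_on) auto
  have hm: "(\<lambda>x. indicator {0<..} x * h x) \<in> borel_measurable borel"
    using borel_measurable_continuous_on_indicator[OF _ hcont] by simp
  have Lh: "has_bochner_integral lborel (\<lambda>x. indicator {0<..} x * (exp (- l * x) * h x)) (1 / l)" if l: "l > 0" for l
  proof (rule has_bochner_integral_nn_integral)
    have "(\<lambda>x. exp (- l * x) * (indicator {0<..} x * h x)) \<in> borel_measurable lborel"
      using hm by simp
    thus "(\<lambda>x. indicator {0<..} x * (exp (- l * x) * h x)) \<in> borel_measurable lborel"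
      by (simp add: mult_ac)
    have "H x = 0" if "x \<le> 0" for x
    proof -
      have "A' (x - t) * k' t = 0" for t using that by (auto simp: A'_def k'_def indicator_def)
      thus ?thesis by (simp only: H_def) simp
    qed
    hence "ennreal (indicator {0<..} x * (exp (- l * x) * h x)) = ennreal (exp (- l * x)) * H x" for x
      by (cases "x > 0") (auto simp: Hg h_def ennreal_mult g_nn)
    thus "(\<integral>\<^sup>+ x. ennreal (indicator {0<..} x * (exp (- l * x) * h x)) \<partial>lborel) = ennreal (1 / l)"
      using LH[OF l] by simp
  qed (use l g_nn in \<open>auto simp: h_def indicator_def\<close>)
  have L1: "has_bochner_integral lborel (\<lambda>x. indicator {0<..} x * exp (- l * x)) (1 / l)" if l: "l > 0" for l :: real
    using nn_integral_exp_Ioi[OF l] l by (intro has_bochner_integral_nn_integral) auto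
  have diff: "has_bochner_integral lborel (\<lambda>x. indicator {0<..} x * (exp (- l * x) * (h x - 1))) 0"
    "has_bochner_integral lborel (\<lambda>x. indicator {0<..} x * (exp (- l * x) * (1 - h x))) 0" if l: "l > 0" for l
    using has_bochner_integral_diff[OF Lh[OF l] L1[OF l]] has_bochner_integral_diff[OF L1[OF l] Lh[OF l]]
    by (auto simp: algebra_simps)
  \<comment> \<open>The transform at 1 supplies integrability, those at the positive integers the
    vanishing moments. The uniqueness lemma is one-sided and is therefore applied to h - 1 and to 1
    - h.\<close>
  have "h x - 1 \<le> 0"
    using diff(1)[of 1] diff(1)[of "real (Suc n)" for n] hcont \<open>x > 0\<close>
    by (intro Laplace_transform_zero_nonpos[where d = "\<lambda>x. h x - 1"])
       (auto simp: set_integrable_def set_lebesgue_integral_def has_bochner_integral_iff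
             intro!: continuous_intros simp del: of_nat_Suc)
  moreover have "1 - h x \<le> 0"
    using diff(2)[of 1] diff(2)[of "real (Suc n)" for n] hcont \<open>x > 0\<close>
    by (intro Laplace_transform_zero_nonpos[where d = "\<lambda>x. 1 - h x"])
       (auto simp: set_integrable_def set_lebesgue_integral_def has_bochner_integral_iff
             intro!: continuous_intros simp del: of_nat_Suc)
  ultimately have "H x = ennreal 1" using Hg[OF \<open>x > 0\<close>] by (simp add: h_def)
  hence "has_bochner_integral lborel (\<lambda>t. A' (x - t) * k' t) 1"
    unfolding H_def using nn by (intro has_bochner_integral_nn_integral) auto
  also have "(\<lambda>t. A' (x - t) * k' t) = (\<lambda>t. indicator {0<..<x} t * (A (x - t) * k t))"
    by (auto simp: A'_def k'_def indicator_def)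
  finally show ?thesis .
qed

section \<open>Convolution\<close>

lemma convolution_commute: "convolution h \<phi> x = convolution \<phi> h x"
proof -
  have "convolution h \<phi> x = (LINT t|lborel. indicator {0<..<x} (x + - 1 * t) *\<^sub>R (h (x - (x + - 1 * t)) * \<phi> (x + - 1 * t)))"
    unfolding convolution_def set_lebesgue_integral_def
    by (subst lborel_integral_real_affine[where c = "-1" and t = x]) auto
  also have "\<dots> = convolution \<phi> h x"
    unfolding convolution_def set_lebesgue_integral_def
    by (intro Bochner_Integration.integral_cong) (auto simp: indicator_def)
  finally show ?thesis .
qed

lemma convolution_integrable_commute:
  fixes h \<phi> :: "real \<Rightarrow> real"
  shows "set_integrable lborel {0<..<x} (\<lambda>t. h (x - t) * \<phi> t) \<longleftrightarrow>
   set_integrable lborel {0<..<x} (\<lambda>t. \<phi> (x - t) * h t)"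
proof -
  have "set_integrable lborel {0<..<x} (\<lambda>t. h (x - t) * \<phi> t) \<longleftrightarrow>
    integrable lborel (\<lambda>t. indicator {0<..<x} (x + - 1 * t) *\<^sub>R (h (x - (x + - 1 * t)) * \<phi> (x + - 1 * t)))"
    unfolding set_integrable_def by (subst lborel_integrable_real_affine_iff) auto
  also have "(\<lambda>t. indicator {0<..<x} (x + - 1 * t) *\<^sub>R (h (x - (x + - 1 * t)) * \<phi> (x + - 1 * t)))
     = (\<lambda>t. indicator {0<..<x} t *\<^sub>R (\<phi> (x - t) * h t))"
    by (auto simp: indicator_def)
  finally show ?thesis unfolding set_integrable_def .
qed

lemma convolution_cong:
  assumes "\<And>t. t \<in> {0<..<x} \<Longrightarrow> h t = h' t" "\<And>t. t \<in> {0<..<x} \<Longrightarrow> \<phi> t = \<phi>' t"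
  shows "convolution h \<phi> x = convolution h' \<phi>' x"
  unfolding convolution_def using assms by (intro set_lebesgue_integral_cong) auto

lemma set_integrable_mult_bounded:
  fixes h w :: "real \<Rightarrow> real"
  assumes "set_integrable lborel S h" "set_borel_measurable lborel S w" "\<And>t. t \<in> S \<Longrightarrow> \<bar>w t\<bar> \<le> C"
  shows "set_integrable lborel S (\<lambda>t. h t * w t)"
proof (cases "S = {}")
  case False
  then obtain t0 where "t0 \<in> S" by auto
  with assms(3)[of t0] have C: "C \<ge> 0" by auto
  show ?thesis unfolding set_integrable_def
  proof (rule Bochner_Integration.integrable_bound)
    show "integrable lborel (\<lambda>t. C * (indicator S t *\<^sub>R h t))"
      using assms(1) unfolding set_integrable_def by (rule integrable_mult_right)
    have "(\<lambda>t. (indicator S t *\<^sub>R h t) * (indicator S t *\<^sub>R w t)) \<in> borel_measurable lborel"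
      using borel_measurable_integrable[OF assms(1)[unfolded set_integrable_def]]
        assms(2)[unfolded set_borel_measurable_def] by (rule borel_measurable_times)
    also have "(\<lambda>t. (indicator S t *\<^sub>R h t) * (indicator S t *\<^sub>R w t)) = (\<lambda>t. indicator S t *\<^sub>R (h t * w t))"
      by (auto simp: indicator_def)
    finally show "(\<lambda>t. indicator S t *\<^sub>R (h t * w t)) \<in> borel_measurable lborel" .
    show "AE t in lborel. norm (indicator S t *\<^sub>R (h t * w t)) \<le> norm (C * (indicator S t *\<^sub>R h t))"
    proof (rule AE_I2)
      fix t
      have "\<bar>h t\<bar> * \<bar>w t\<bar> \<le> \<bar>h t\<bar> * C" if "t \<in> S"
        using assms(3)[OF that] by (intro mult_left_mono) auto
      thus "norm (indicator S t *\<^sub>R (h t * w t)) \<le> norm (C * (indicator S t *\<^sub>R h t))"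
        using C by (auto simp: indicator_def abs_mult mult_ac)
    qed
  qed
qed (simp add: set_integrable_def)

lemma set_measurable_shifted_interval:
  fixes h :: "real \<Rightarrow> real"
  assumes "set_borel_measurable lborel {0<..<x} h"
  shows "set_borel_measurable lborel {0<..<x} (\<lambda>t. h (x - t))"
proof -
  have "(\<lambda>t. indicator {0<..<x} (x - t) *\<^sub>R h (x - t)) \<in> borel_measurable lborel"
    using assms unfolding set_borel_measurable_def by measurable
  also have "(\<lambda>t. indicator {0<..<x} (x - t) *\<^sub>R h (x - t)) = (\<lambda>t. indicator {0<..<x} t *\<^sub>R h (x - t))"
    by (auto simp: indicator_def)
  finally show ?thesis unfolding set_borel_measurable_def .
qed

text \<open>Dominated convergence with majorant |C| |k|. Although \<open>w\<close> may have no limit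
  at 0, its extension by 0 is continuous at x - t for every t in (0, T) except t = x: such t keep x
  - t below T, so the jump at T is never met.\<close>

lemma convolution_continuous_on:
  fixes w k :: "real \<Rightarrow> real"
  assumes w: "continuous_on {0<..T} w" "\<And>t. t \<in> {0<..T} \<Longrightarrow> \<bar>w t\<bar> \<le> C"
    and k: "set_integrable lborel {0<..<T} k"
  shows "continuous_on {0..T} (convolution w k)"
proof (rule continuous_on_sequentiallyI)
  fix u :: "nat \<Rightarrow> real" and x assume u: "\<forall>n. u n \<in> {0..T}" and x: "x \<in> {0..T}" and lim: "u \<longlonglongrightarrow> x"
  define K where "K = (\<lambda>t. indicator {0<..<T} t *\<^sub>R k t)"
  have K: "integrable lborel K" using k by (simp add: K_def set_integrable_def)
  define w' where "w' = (\<lambda>t. indicator {0<..T} t *\<^sub>R w t)"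
  have [measurable]: "w' \<in> borel_measurable borel"
    unfolding w'_def by (intro borel_measurable_continuous_on_indicator w) auto
  have eq: "convolution w k y = (LINT t|lborel. w' (y - t) * K t)" if "y \<in> {0..T}" for y
    unfolding convolution_def set_lebesgue_integral_def w'_def K_def using that
    by (intro Bochner_Integration.integral_cong) (auto simp: indicator_def)
  have w': "\<bar>w' t\<bar> \<le> \<bar>C\<bar>" for t using w(2)[of t] by (auto simp: w'_def indicator_def)
  have "(\<lambda>n. LINT t|lborel. w' (u n - t) * K t) \<longlonglongrightarrow> (LINT t|lborel. w' (x - t) * K t)"
  proof (rule integral_dominated_convergence)
    show "integrable lborel (\<lambda>t. \<bar>C\<bar> * \<bar>K t\<bar>)" using K by auto
    show "AE t in lborel. norm (w' (u i - t) * K t) \<le> \<bar>C\<bar> * \<bar>K t\<bar>" for i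
      using w' by (auto simp: abs_mult intro!: mult_right_mono)
    have [measurable]: "K \<in> borel_measurable borel" using K by auto
    show "(\<lambda>t. w' (x - t) * K t) \<in> borel_measurable lborel" by measurable
    show "(\<lambda>t. w' (u i - t) * K t) \<in> borel_measurable lborel" for i by measurable
    show "AE t in lborel. (\<lambda>i. w' (u i - t) * K t) \<longlonglongrightarrow> w' (x - t) * K t"
      using AE_lborel_singleton[of x]
    proof eventually_elim
      case (elim t)
      show ?case
      proof (cases "t \<in> {0<..<T}")
        case True
        have l: "(\<lambda>i. u i - t) \<longlonglongrightarrow> x - t" using lim by (intro tendsto_intros)
        have "isCont w' (x - t)"
        proof (cases "x - t > 0")
          case pos: True
          have o: "open {0<..<T}" "x - t \<in> {0<..<T}" using pos True x by auto
          have "isCont w (x - t)"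
            using continuous_on_interior[OF w(1), of "x - t"] o by simp
          moreover have "eventually (\<lambda>y. w' y = w y) (nhds (x - t))"
            using eventually_nhds_in_open[OF o] by eventually_elim (auto simp: w'_def)
          ultimately show ?thesis by (subst isCont_cong) auto
        next
          case False
          hence o: "open {..<0::real}" "x - t \<in> {..<0}" using elim by auto
          have "eventually (\<lambda>y. w' y = 0) (nhds (x - t))"
            using eventually_nhds_in_open[OF o] by eventually_elim (auto simp: w'_def)
          thus ?thesis by (subst isCont_cong[where g = "\<lambda>_. 0"]) auto
        qed
        hence "(\<lambda>i. w' (u i - t)) \<longlonglongrightarrow> w' (x - t)" using l by (rule isCont_tendsto_compose)
        thus ?thesis by (intro tendsto_intros)
      qed (simp add: K_def)
    qed
  qed
  thus "(\<lambda>n. convolution w k (u n)) \<longlonglongrightarrow> convolution w k x"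
    using u x by (simp add: eq)
qed

text \<open>Fubini on the triangle 0 < s < t < x. The inner convolution of |A| and |B| is bounded by
  \<open>M\<close> at every point x - s, so that integrability of \<open>C\<close> alone makes the
  double integral absolutely convergent. In the applications \<open>M\<close> is 1 for the Sonine
  pair and \<kappa> for the pair of 1 and k.\<close>

lemma convolution_assoc:
  fixes A B C :: "real \<Rightarrow> real"
  assumes m: "set_borel_measurable lborel {0<..<x} A" "set_borel_measurable lborel {0<..<x} B"
    and int: "\<And>s. s \<in> {0<..<x} \<Longrightarrow> set_integrable lborel {0<..<x - s} (\<lambda>t. A (x - s - t) * B t)"
    and bd: "\<And>s. s \<in> {0<..<x} \<Longrightarrow> (LBINT t:{0<..<x - s}. \<bar>A (x - s - t) * B t\<bar>) \<le> M"
    and C: "set_integrable lborel {0<..<x} C"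
  shows "convolution A (convolution B C) x = convolution (convolution A B) C x"
proof -
  define a where "a = (\<lambda>t. indicator {0<..<x} t *\<^sub>R A t)"
  define b where "b = (\<lambda>t. indicator {0<..<x} t *\<^sub>R B t)"
  define c where "c = (\<lambda>t. indicator {0<..<x} t *\<^sub>R C t)"
  have c: "integrable lborel c" using C by (simp add: c_def set_integrable_def)
  have [measurable]: "a \<in> borel_measurable borel" "b \<in> borel_measurable borel" "c \<in> borel_measurable borel"
    using m c by (auto simp: a_def b_def set_borel_measurable_def)
  \<comment> \<open>The cut-offs in \<open>a\<close>, \<open>b\<close> and \<open>c\<close> confine
    \<open>F\<close> to the triangle, so both iterated integrals can run over the whole
    line.\<close>
  define F where "F = (\<lambda>(s, t). a (x - t) * b (t - s) * c s)"
  have Fm [measurable]: "F \<in> borel_measurable (lborel \<Otimes>\<^sub>M lborel)"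
    unfolding F_def by measurable
  have shift: "a (x - s - r) * b r = indicator {0<..<x - s} r *\<^sub>R (A (x - s - r) * B r)" if "s \<in> {0<..<x}" for s r
    using that by (auto simp: a_def b_def indicator_def)
  have ab: "integrable lborel (\<lambda>r. a (x - s - r) * b r)" if "s \<in> {0<..<x}" for s
    using int[OF that] by (simp only: shift[OF that] set_integrable_def)
  have abt: "integrable lborel (\<lambda>t. a (x - t) * b (t - s))" if "s \<in> {0<..<x}" for s
    using lborel_integrable_real_affine[OF ab[OF that], of 1 "- s"] by simp
  have Fint: "integrable (lborel \<Otimes>\<^sub>M lborel) F"
  proof (rule lborel_pair.Fubini_integrable[OF Fm])
    show "integrable lborel (\<lambda>s. LINT t|lborel. norm (F (s, t)))"
    proof (rule Bochner_Integration.integrable_bound)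
      show "integrable lborel (\<lambda>s. M * c s)" using c by simp
      show "(\<lambda>s. LINT t|lborel. norm (F (s, t))) \<in> borel_measurable lborel" by measurable
      show "AE s in lborel. norm (LINT t|lborel. norm (F (s, t))) \<le> norm (M * c s)"
      proof (rule AE_I2)
        fix s :: real
        show "norm (LINT t|lborel. norm (F (s, t))) \<le> norm (M * c s)"
        proof (cases "s \<in> {0<..<x}")
          case True
          have "(LINT t|lborel. norm (F (s, t))) = (LINT t|lborel. \<bar>a (x - t) * b (t - s)\<bar>) * \<bar>c s\<bar>"
            by (simp add: F_def abs_mult)
          also have "(LINT t|lborel. \<bar>a (x - t) * b (t - s)\<bar>) = (LINT r|lborel. \<bar>a (x - s - r) * b r\<bar>)"
            by (subst lborel_integral_real_affine[where c = 1 and t = s]) (auto simp: algebra_simps)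
          also have "\<dots> = (LBINT t:{0<..<x - s}. \<bar>A (x - s - t) * B t\<bar>)"
            unfolding set_lebesgue_integral_def by (simp only: shift[OF True]) (simp add: abs_mult)
          finally have e: "(LINT t|lborel. norm (F (s, t))) = (LBINT t:{0<..<x - s}. \<bar>A (x - s - t) * B t\<bar>) * \<bar>c s\<bar>" .
          have "(LBINT t:{0<..<x - s}. \<bar>A (x - s - t) * B t\<bar>) \<ge> 0"
            unfolding set_lebesgue_integral_def by (intro Bochner_Integration.integral_nonneg) auto
          thus ?thesis using bd[OF True] unfolding e by (auto simp: abs_mult intro!: mult_right_mono)
        qed (simp add: F_def c_def)
      qed
    qed
    show "AE s in lborel. integrable lborel (\<lambda>t. F (s, t))"
    proof (rule AE_I2)
      fix s :: real
      show "integrable lborel (\<lambda>t. F (s, t))"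
        using abt[of s] by (cases "s \<in> {0<..<x}") (auto simp: F_def c_def)
    qed
  qed
  have "(LINT t|lborel. LINT s|lborel. F (s, t)) = (LINT s|lborel. LINT t|lborel. F (s, t))"
    using lborel_pair.Fubini_integral[of "\<lambda>s t. F (s, t)"] Fint by simp
  also have "(LINT t|lborel. LINT s|lborel. F (s, t)) = convolution A (convolution B C) x"
    unfolding convolution_def set_lebesgue_integral_def
  proof (rule Bochner_Integration.integral_cong[OF refl])
    fix t :: real
    show "(LINT s|lborel. F (s, t)) = indicator {0<..<x} t *\<^sub>R
        (A (x - t) * (LINT s|lborel. indicator {0<..<t} s *\<^sub>R (B (t - s) * C s)))"
    proof (cases "t \<in> {0<..<x}")
      case True
      have "F (s, t) = A (x - t) * (indicator {0<..<t} s *\<^sub>R (B (t - s) * C s))" for s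
        using True by (auto simp: F_def a_def b_def c_def indicator_def)
      thus ?thesis using True by simp
    next
      case False
      hence "F (s, t) = 0" for s by (auto simp: F_def a_def indicator_def)
      thus ?thesis using False by simp
    qed
  qed
  also have "(LINT s|lborel. LINT t|lborel. F (s, t)) = convolution (convolution A B) C x"
    unfolding convolution_def set_lebesgue_integral_def
  proof (rule Bochner_Integration.integral_cong[OF refl])
    fix s :: real
    show "(LINT t|lborel. F (s, t)) = indicator {0<..<x} s *\<^sub>R
        ((LINT t|lborel. indicator {0<..<x - s} t *\<^sub>R (A (x - s - t) * B t)) * C s)"
    proof (cases "s \<in> {0<..<x}")
      case True
      have "(LINT t|lborel. F (s, t)) = (LINT t|lborel. a (x - t) * b (t - s)) * c s"
        by (simp add: F_def)
      also have "(LINT t|lborel. a (x - t) * b (t - s)) = (LINT r|lborel. a (x - s - r) * b r)"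
        by (subst lborel_integral_real_affine[where c = 1 and t = s]) (auto simp: algebra_simps)
      finally show ?thesis using True by (simp only: shift[OF True]) (simp add: c_def)
    qed (simp add: F_def c_def)
  qed
  finally show ?thesis .
qed

text \<open>The integrand is integrable up to 0 but may be unbounded there. The fundamental theorem
  is therefore used for the Henstock-Kurzweil integral over [0, T], with 0 removed from the set
  within which the derivative is taken.\<close>

lemma LBINT_Ioo_has_real_derivative:
  fixes p :: "real \<Rightarrow> real"
  assumes p: "continuous_on {0<..T} p" "set_integrable lborel {0<..<T} p" and x: "x \<in> {0<..T}"
  shows "((\<lambda>y. LBINT t:{0<..<y}. p t) has_real_derivative p x) (at x within {0<..T})"
proof -
  have eq: "(LBINT t:{0<..<y}. p t) = integral {0..y} p" if "y \<in> {0<..T}" for y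
  proof -
    have "set_integrable lborel {0<..<y} p" using that by (intro set_integrable_subset[OF p(2)]) auto
    from set_borel_integral_eq_integral(2)[OF this] show ?thesis
      by (simp add: integral_open_interval_real)
  qed
  have "p integrable_on {0<..<T}" using set_borel_integral_eq_integral(1)[OF p(2)] .
  hence i: "p integrable_on {0..T}" by (simp add: integrable_on_open_interval_real)
  have s: "{0..T} - {0} = {0<..T}" by auto
  have "continuous (at x within {0<..T}) p" using p(1) x by (simp add: continuous_on_eq_continuous_within)
  hence "((\<lambda>u. integral {0..u} p) has_vector_derivative p x) (at x within {0<..T})"
    using integral_has_vector_derivative_continuous_at[OF i, of x "{0}"] x by (simp add: s)
  hence "((\<lambda>u. integral {0..u} p) has_real_derivative p x) (at x within {0<..T})"
    by (simp add: has_real_derivative_iff_has_vector_derivative)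
  thus ?thesis
    by (rule has_field_derivative_transform_within[OF _ zero_less_one x]) (simp add: eq)
qed

section \<open>Contraction and uniqueness\<close>

lemma LBINT_nonneg_mono:
  fixes h :: "real \<Rightarrow> real"
  assumes "set_integrable lborel {0<..<y} h" "\<And>t. t > 0 \<Longrightarrow> h t \<ge> 0" "x \<le> y"
  shows "(LBINT t:{0<..<x}. h t) \<le> (LBINT t:{0<..<y}. h t)"
proof -
  have "set_integrable lborel {0<..<x} h"
    using assms by (intro set_integrable_subset[OF assms(1)]) auto
  thus ?thesis using assms unfolding set_lebesgue_integral_def set_integrable_def
    by (intro integral_mono) (auto simp: indicator_def)
qed

lemma abs_convolution_le:
  assumes w: "set_borel_measurable lborel {0<..<x} w" "\<And>t. t \<in> {0<..<x} \<Longrightarrow> \<bar>w t\<bar> \<le> C"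
    and h: "set_integrable lborel {0<..<x} h" "\<And>t. t \<in> {0<..<x} \<Longrightarrow> h t \<ge> 0"
  shows "set_integrable lborel {0<..<x} (\<lambda>t. w (x - t) * h t)"
    and "\<bar>convolution w h x\<bar> \<le> C * (LBINT t:{0<..<x}. h t)"
proof -
  have "set_integrable lborel {0<..<x} (\<lambda>t. h t * w (x - t))"
    using w by (intro set_integrable_mult_bounded[where C = C, OF h(1) set_measurable_shifted_interval]) auto
  thus i: "set_integrable lborel {0<..<x} (\<lambda>t. w (x - t) * h t)" by (simp add: mult.commute)
  have "\<bar>w (x - t) * h t\<bar> \<le> C * h t" if "t \<in> {0<..<x}" for t
    using w(2)[of "x - t"] h(2)[OF that] that by (auto simp: abs_mult intro!: mult_right_mono)
  moreover have Ch: "set_integrable lborel {0<..<x} (\<lambda>t. C * h t)"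
    by (intro set_integrable_mult_right h(1))
  ultimately have "\<bar>convolution w h x\<bar> \<le> (LBINT t:{0<..<x}. C * h t)"
    unfolding convolution_def set_lebesgue_integral_def
    using i[unfolded set_integrable_def] Ch[unfolded set_integrable_def]
    by (intro integral_abs_bound_integral) (auto simp: indicator_def)
  thus "\<bar>convolution w h x\<bar> \<le> C * (LBINT t:{0<..<x}. h t)" by simp
qed

text \<open>Makes derivatives within (0, T] unique, also at T, where approach is only from the
  left.\<close>

lemma at_within_Ioc_neq_bot:
  fixes x :: real
  assumes "x \<in> {0<..T}"
  shows "at x within {0<..T} \<noteq> bot"
proof -
  have "x islimpt {0<..<x}" using assms by (intro islimpt_greaterThanLessThan2) auto
  hence "x islimpt {0<..T}" by (rule islimpt_subset) (use assms in auto)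
  thus ?thesis by (simp add: trivial_limit_within)
qed

section \<open>Sonine pairs, the weight \<kappa> and the contraction constant\<close>

locale sonine_pair =
  fixes A k :: "real \<Rightarrow> real"
  assumes A_cont: "continuous_on {0<..} A"
    and A_nonneg: "\<And>x. x > 0 \<Longrightarrow> A x \<ge> 0" and k_nonneg: "\<And>x. x > 0 \<Longrightarrow> k x \<ge> 0"
    and A_int: "\<And>x. set_integrable lborel {0<..<x} A" and k_int: "\<And>x. set_integrable lborel {0<..<x} k"
    and sonine: "\<And>x. x > 0 \<Longrightarrow>
      has_bochner_integral lborel (\<lambda>t. indicator {0<..<x} t * (A (x - t) * k t)) 1"
begin

definition \<kappa> :: "real \<Rightarrow> real" where
  "\<kappa> x = (LBINT s:{0<..<x}. k s)"

text \<open>The integral operator without a separate value at 0: \<open>K \<phi> 0\<close> is 0, an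
  integral over the empty set. It agrees with \<open>K_op\<close> for functions vanishing at
  0.\<close>

definition K :: "(real \<Rightarrow> real) \<Rightarrow> real \<Rightarrow> real" where
  "K \<phi> = convolution k (\<lambda>r. A r * \<phi> r)"

lemma A_measurable: "set_borel_measurable lborel {0<..<x} A"
  and k_measurable: "set_borel_measurable lborel {0<..<x} k"
  using A_int[of x] k_int[of x] unfolding set_integrable_def set_borel_measurable_def by auto

lemma \<kappa>_continuous: "continuous_on {0..T} \<kappa>"
  using convolution_continuous_on[of T "\<lambda>_. 1" 1 k] k_int[of T]
  by (simp add: \<kappa>_def[abs_def] convolution_def[abs_def])

lemma \<kappa>_0 [simp]: "\<kappa> 0 = 0"
  by (simp add: \<kappa>_def set_lebesgue_integral_def)

lemma \<kappa>_mono: "x \<le> y \<Longrightarrow> \<kappa> x \<le> \<kappa> y"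
  unfolding \<kappa>_def by (rule LBINT_nonneg_mono[OF k_int k_nonneg])

lemma \<kappa>_nonneg: "\<kappa> x \<ge> 0"
  unfolding \<kappa>_def set_lebesgue_integral_def using k_nonneg
  by (intro Bochner_Integration.integral_nonneg) (auto simp: indicator_def)

text \<open>If \<kappa> x were 0, then k would vanish almost everywhere on (0, x), and the Sonine
  integral at x would be 0 instead of 1.\<close>

lemma \<kappa>_pos:
  assumes "x > 0"
  shows "\<kappa> x > 0"
proof (rule ccontr)
  assume "\<not> \<kappa> x > 0"
  hence "\<kappa> x = 0" using \<kappa>_nonneg[of x] by simp
  hence "AE t in lborel. indicator {0<..<x} t *\<^sub>R k t = 0"
    unfolding \<kappa>_def set_lebesgue_integral_def using k_int[of x, unfolded set_integrable_def] k_nonneg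
    by (subst (asm) integral_nonneg_eq_0_iff_AE) (auto simp: indicator_def)
  hence "AE t in lborel. indicator {0<..<x} t * (A (x - t) * k t) = 0"
    by eventually_elim (auto simp: indicator_def)
  hence "(LINT t|lborel. indicator {0<..<x} t * (A (x - t) * k t)) = 0"
    by (rule integral_eq_zero_AE)
  thus False using sonine[OF assms] by (simp add: has_bochner_integral_iff)
qed

lemma kernel_integrable: "set_integrable lborel {0<..<x} (\<lambda>r. k (x - r) * A r)"
proof (cases "x > 0")
  case True
  have "set_integrable lborel {0<..<x} (\<lambda>r. A (x - r) * k r)"
    using sonine[OF True] by (simp add: has_bochner_integral_iff set_integrable_def)
  thus ?thesis by (subst convolution_integrable_commute)
qed (simp add: set_integrable_def)

lemma convolution_k_A: "x > 0 \<Longrightarrow> convolution k A x = 1"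
  using sonine[of x] by (subst convolution_commute)
    (simp add: convolution_def set_lebesgue_integral_def has_bochner_integral_iff)

text \<open>\<open>?D\<close> is the nonnegative integrand (A(x - t) - A x) k t with integral 1 - A
  x \<kappa> x. If this is not positive, the integrand vanishes almost everywhere. As A x is then
  not 0, \<open>strict\<close> makes the first factor nonzero for every t in (0, x), so k vanishes
  almost everywhere on (0, x), contradicting \<open>\<kappa>_pos\<close>.\<close>

lemma mult_Ak_less_1:
  assumes anti: "antimono_on {0<..} A" and "x > 0"
    and strict: "\<And>y. 0 < y \<Longrightarrow> y < x \<Longrightarrow> A y = A x \<Longrightarrow> A x = 0"
  shows "A x * \<kappa> x < 1"
proof (rule ccontr)
  assume n: "\<not> A x * \<kappa> x < 1"
  hence Ax: "A x \<noteq> 0" by auto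
  let ?D = "\<lambda>t. indicator {0<..<x} t * (A (x - t) * k t) - A x * (indicator {0<..<x} t *\<^sub>R k t)"
  have D: "has_bochner_integral lborel ?D (1 - A x * \<kappa> x)"
    using k_int[of x] unfolding \<kappa>_def set_integrable_def set_lebesgue_integral_def
    by (intro has_bochner_integral_diff sonine[OF \<open>x > 0\<close>] has_bochner_integral_mult_right)
       (auto simp: has_bochner_integral_iff)
  have Dnn: "?D t \<ge> 0" for t
  proof (cases "t \<in> {0<..<x}")
    case True
    hence "A x \<le> A (x - t)" by (intro monotone_onD[OF anti]) auto
    hence "A x * k t \<le> A (x - t) * k t" using True k_nonneg by (intro mult_right_mono) auto
    thus ?thesis using True by simp
  qed simp
  have "(LINT t|lborel. ?D t) \<ge> 0" using Dnn by (rule Bochner_Integration.integral_nonneg)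
  hence "(LINT t|lborel. ?D t) = 0" using D n by (simp add: has_bochner_integral_iff)
  hence "AE t in lborel. ?D t = 0"
    using D Dnn by (subst (asm) integral_nonneg_eq_0_iff_AE) (auto simp: has_bochner_integral_iff)
  hence "AE t in lborel. indicator {0<..<x} t *\<^sub>R k t = 0"
  proof eventually_elim
    case (elim t)
    show ?case
    proof (cases "t \<in> {0<..<x}")
      case True
      hence "(A (x - t) - A x) * k t = 0" using elim by (simp add: algebra_simps)
      moreover have "A (x - t) \<noteq> A x" using strict[of "x - t"] True Ax by auto
      ultimately show ?thesis by simp
    qed simp
  qed
  hence "\<kappa> x = 0" unfolding \<kappa>_def set_lebesgue_integral_def by (rule integral_eq_zero_AE)
  thus False using \<kappa>_pos[OF \<open>x > 0\<close>] by simp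
qed

lemma ex_contraction_constant:
  assumes "T > 0" and less: "\<And>x. x > 0 \<Longrightarrow> A x * \<kappa> x < 1"
    and ls: "Limsup (at_right 0) (\<lambda>x. ereal (A x * \<kappa> x)) < 1"
  shows "\<exists>q. 0 \<le> q \<and> q < 1 \<and> (\<forall>x\<in>{0<..T}. A x * \<kappa> x \<le> q)"
proof -
  obtain r where r: "Limsup (at_right 0) (\<lambda>x. ereal (A x * \<kappa> x)) < ereal r" "ereal r < 1"
    using ereal_dense2[OF ls] by auto
  have "eventually (\<lambda>x. ereal (A x * \<kappa> x) < ereal r) (at_right 0)" using Limsup_lessD[OF r(1)] .
  then obtain b where b: "b > 0" "\<And>x. 0 < x \<Longrightarrow> x < b \<Longrightarrow> A x * \<kappa> x < r"
    unfolding eventually_at_right_field by auto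
  \<comment> \<open>The limsup condition controls (0, b), compactness the rest; the minimum keeps
    [d, T] nonempty even if b exceeds T.\<close>
  define d where "d = min b T"
  have c: "continuous_on {d..T} (\<lambda>x. A x * \<kappa> x)"
    using b \<open>T > 0\<close>
    by (intro continuous_intros continuous_on_subset[OF A_cont] continuous_on_subset[OF \<kappa>_continuous[of T]])
       (auto simp: d_def min_def split: if_splits)
  have ne: "{d..T} \<noteq> {}" by (simp add: d_def)
  obtain z where z: "z \<in> {d..T}" "\<And>x. x \<in> {d..T} \<Longrightarrow> A x * \<kappa> x \<le> A z * \<kappa> z"
    using continuous_attains_sup[OF compact_Icc ne c] by blast
  define q where "q = max 0 (max r (A z * \<kappa> z))"
  have "z > 0" using z(1) b(1) \<open>T > 0\<close> by (auto simp: d_def)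
  hence "q < 1" using less[of z] r(2) by (simp add: q_def)
  moreover have "A x * \<kappa> x \<le> q" if "x \<in> {0<..T}" for x
    using b(2)[of x] z(2)[of x] that by (cases "x < b") (auto simp: q_def d_def)
  ultimately show ?thesis by (intro exI[of _ q]) (auto simp: q_def)
qed

end

section \<open>The operator \<open>K\<close> in the weighted norm\<close>

locale sonine_contraction = sonine_pair +
  fixes T q :: real
  assumes T_pos: "T > 0" and q: "0 \<le> q" "q < 1"
    and A\<kappa>_le: "\<And>x. x \<in> {0<..T} \<Longrightarrow> A x * \<kappa> x \<le> q"
begin

lemma set_measurable_Ioc:
  fixes \<phi> :: "real \<Rightarrow> real"
  assumes "continuous_on {0<..T} \<phi>" "x \<le> T"
  shows "set_borel_measurable lborel {0<..<x} \<phi>"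
proof -
  have "continuous_on {0<..<x} \<phi>" using assms by (auto intro: continuous_on_subset)
  thus ?thesis unfolding set_borel_measurable_def
    using borel_measurable_continuous_on_indicator[of "{0<..<x}" \<phi>] by simp
qed

lemma A_continuous_Ioc: "continuous_on {0<..T} A"
  by (rule continuous_on_subset[OF A_cont]) auto

lemma K_integrable:
  assumes "continuous_on {0<..T} \<phi>" "\<And>r. r \<in> {0<..T} \<Longrightarrow> \<bar>\<phi> r\<bar> \<le> C" "x \<le> T"
  shows "set_integrable lborel {0<..<x} (\<lambda>r. k (x - r) * (A r * \<phi> r))"
proof -
  have "set_integrable lborel {0<..<x} (\<lambda>r. k (x - r) * A r * \<phi> r)"
    using assms by (intro set_integrable_mult_bounded[where C = C, OF kernel_integrable set_measurable_Ioc]) auto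
  thus ?thesis by (simp add: mult.assoc)
qed

text \<open>The two terms behave differently under \<open>K\<close>: e is reproduced because k * A =
  1, while c \<kappa> gains the factor q because A \<kappa> \<le> q and k * 1 = \<kappa>.\<close>

lemma K_bound:
  assumes \<phi>: "continuous_on {0<..T} \<phi>" "\<And>r. r \<in> {0<..T} \<Longrightarrow> \<bar>\<phi> r\<bar> \<le> e + c * \<kappa> r"
    and c: "c \<ge> 0" and x: "x \<in> {0<..T}"
  shows "\<bar>K \<phi> x\<bar> \<le> e + c * q * \<kappa> x"
proof -
  have kx: "set_integrable lborel {0<..<x} (\<lambda>r. k (x - r))" "(LBINT r:{0<..<x}. k (x - r)) = \<kappa> x"
    using convolution_integrable_commute[of x k "\<lambda>_. 1"] convolution_commute[of k "\<lambda>_. 1" x] k_int[of x]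
    by (auto simp: convolution_def \<kappa>_def)
  let ?g = "\<lambda>r. e * (indicator {0<..<x} r *\<^sub>R (k (x - r) * A r)) + c * q * (indicator {0<..<x} r *\<^sub>R k (x - r))"
  have g: "has_bochner_integral lborel ?g (e * 1 + c * q * \<kappa> x)"
    using kernel_integrable[of x] kx convolution_k_A[of x] x
    by (intro has_bochner_integral_add has_bochner_integral_mult_right)
       (auto simp: has_bochner_integral_iff set_integrable_def set_lebesgue_integral_def convolution_def)
  have b: "\<bar>\<phi> r\<bar> \<le> e + c * \<kappa> T" if "r \<in> {0<..T}" for r
    using \<phi>(2)[OF that] mult_left_mono[OF \<kappa>_mono[of r T] c] that by auto
  have f: "integrable lborel (\<lambda>r. indicator {0<..<x} r *\<^sub>R (k (x - r) * (A r * \<phi> r)))"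
    using K_integrable[OF \<phi>(1) b, of x] x by (simp add: set_integrable_def)
  have fg: "\<bar>indicator {0<..<x} r *\<^sub>R (k (x - r) * (A r * \<phi> r))\<bar> \<le> ?g r" for r
  proof (cases "r \<in> {0<..<x}")
    case True
    have "A r * \<bar>\<phi> r\<bar> \<le> A r * (e + c * \<kappa> r)"
      using \<phi>(2)[of r] True x A_nonneg by (intro mult_left_mono) auto
    also have "\<dots> = e * A r + c * (A r * \<kappa> r)" by (simp add: algebra_simps)
    also have "\<dots> \<le> e * A r + c * q"
      using A\<kappa>_le[of r] True x c by (intro add_left_mono mult_left_mono) auto
    finally have "k (x - r) * (A r * \<bar>\<phi> r\<bar>) \<le> k (x - r) * (e * A r + c * q)"
      using k_nonneg[of "x - r"] True by (intro mult_left_mono) auto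
    thus ?thesis using True A_nonneg[of r] k_nonneg[of "x - r"] by (simp add: abs_mult algebra_simps)
  qed simp
  have "\<bar>LINT r|lborel. indicator {0<..<x} r *\<^sub>R (k (x - r) * (A r * \<phi> r))\<bar> \<le> (LINT r|lborel. ?g r)"
    using g by (intro integral_abs_bound_integral f fg) (simp add: has_bochner_integral_iff)
  also have "\<dots> = e + c * q * \<kappa> x" using g by (simp add: has_bochner_integral_iff)
  finally show ?thesis by (simp add: K_def convolution_def set_lebesgue_integral_def)
qed

lemma bounded_by_\<kappa>_mult_A:
  assumes "\<bar>y\<bar> \<le> c * \<kappa> r" "c \<ge> 0" "r \<in> {0<..T}"
  shows "\<bar>A r * y\<bar> \<le> c * q"
proof -
  have "A r * \<bar>y\<bar> \<le> A r * (c * \<kappa> r)" using assms A_nonneg by (intro mult_left_mono) auto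
  also have "\<dots> = c * (A r * \<kappa> r)" by simp
  also have "\<dots> \<le> c * q" using A\<kappa>_le assms by (intro mult_left_mono) auto
  finally show ?thesis using A_nonneg[of r] assms by (simp add: abs_mult)
qed

text \<open>The bound by \<kappa> makes A \<phi> bounded by c q despite the singularity of A, and
  convolving a bounded continuous function with the integrable k is continuous up to 0.\<close>

lemma K_continuous_\<kappa>:
  assumes \<phi>: "continuous_on {0<..T} \<phi>" "\<And>r. r \<in> {0<..T} \<Longrightarrow> \<bar>\<phi> r\<bar> \<le> c * \<kappa> r" and c: "c \<ge> 0"
  shows "continuous_on {0..T} (K \<phi>)"
proof -
  have "continuous_on {0..T} (convolution (\<lambda>r. A r * \<phi> r) k)"
    by (rule convolution_continuous_on[where C = "c * q"])
       (intro continuous_intros A_continuous_Ioc \<phi> k_int bounded_by_\<kappa>_mult_A c | assumption)+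
  thus ?thesis unfolding K_def by (subst convolution_commute[abs_def]) auto
qed

lemma K_diff:
  assumes "continuous_on {0<..T} \<phi>" "\<And>r. r \<in> {0<..T} \<Longrightarrow> \<bar>\<phi> r\<bar> \<le> C"
    and "continuous_on {0<..T} \<psi>" "\<And>r. r \<in> {0<..T} \<Longrightarrow> \<bar>\<psi> r\<bar> \<le> D" and "x \<le> T"
  shows "K \<phi> x - K \<psi> x = K (\<lambda>r. \<phi> r - \<psi> r) x"
  unfolding K_def convolution_def
  using set_integral_diff(2)[OF K_integrable[OF assms(1,2,5)] K_integrable[OF assms(3,4,5)]]
  by (simp add: algebra_simps)

text \<open>Continuity at 0 gives |\<phi>| < e on some (0, d), with no rate against \<kappa>. From d
  onwards \<kappa> is at least \<kappa> d > 0, so \<open>M / \<kappa> d\<close> times \<kappa>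
  exceeds the maximum M of |\<phi>|, or equals it.\<close>

lemma bound_eps_\<kappa>:
  assumes \<phi>: "continuous_on {0..T} \<phi>" "\<phi> 0 = 0" and "e > 0"
  obtains c where "c \<ge> 0" "\<And>r. r \<in> {0<..T} \<Longrightarrow> \<bar>\<phi> r\<bar> \<le> e + c * \<kappa> r"
proof -
  obtain d where d: "d > 0" "\<And>r. r \<in> {0..T} \<Longrightarrow> \<bar>r\<bar> < d \<Longrightarrow> \<bar>\<phi> r\<bar> < e"
    using \<phi>(1)[unfolded continuous_on_iff, rule_format, of 0 e] \<phi>(2) \<open>e > 0\<close> T_pos
    by (auto simp: dist_real_def)
  obtain M where M: "\<And>r. r \<in> {0..T} \<Longrightarrow> \<bar>\<phi> r\<bar> \<le> M"
    using compact_imp_bounded[OF compact_continuous_image[OF \<phi>(1) compact_Icc]]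
    unfolding bounded_iff by (metis imageI real_norm_def)
  have M0: "M \<ge> 0" using M[of 0] T_pos by auto
  have kd: "\<kappa> d > 0" using \<kappa>_pos d(1) .
  show ?thesis
  proof
    show "M / \<kappa> d \<ge> 0" using M0 kd by simp
    fix r assume r: "r \<in> {0<..T}"
    have nn: "M / \<kappa> d * \<kappa> r \<ge> 0" using M0 kd \<kappa>_nonneg[of r] by simp
    show "\<bar>\<phi> r\<bar> \<le> e + M / \<kappa> d * \<kappa> r"
    proof (cases "r < d")
      case True
      thus ?thesis using d(2)[of r] r nn by auto
    next
      case False
      hence "M * \<kappa> d \<le> M * \<kappa> r" using M0 by (intro mult_left_mono \<kappa>_mono) auto
      hence "M \<le> M / \<kappa> d * \<kappa> r" using kd by (simp add: field_simps)
      moreover have "\<bar>\<phi> r\<bar> \<le> M" using M[of r] r by auto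
      ultimately show ?thesis using \<open>e > 0\<close> by linarith
    qed
  qed
qed

text \<open>
  \<open>A * \<phi>\<close> need not be bounded near \<open>0\<close>; subtracting the truncation of \<open>\<phi>\<close> to \<open>[- e n, e n]\<close> makes the
  product bounded and changes \<open>K \<phi>\<close> by at most \<open>e n\<close>, because \<open>K\<close> has total mass \<open>1\<close>.
\<close>

lemma K_continuous:
  assumes \<phi>: "continuous_on {0..T} \<phi>" "\<phi> 0 = 0"
  shows "continuous_on {0<..T} (K \<phi>)"
proof -
  have \<phi>': "continuous_on {0<..T} \<phi>" using \<phi>(1) by (rule continuous_on_subset) auto
  define e where "e n = inverse (real (Suc n))" for n
  have e: "e n > 0" for n by (simp add: e_def)
  define tr where "tr n r = max (- e n) (min (e n) (\<phi> r))" for n r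
  have tr: "continuous_on {0<..T} (tr n)" "\<bar>tr n r\<bar> \<le> e n" for n r
    using e[of n] unfolding tr_def by (auto intro!: continuous_intros \<phi>')
  obtain c0 where c0: "c0 \<ge> 0" "\<And>r. r \<in> {0<..T} \<Longrightarrow> \<bar>\<phi> r\<bar> \<le> 1 + c0 * \<kappa> r"
    using bound_eps_\<kappa>[OF \<phi> zero_less_one] by blast
  have \<phi>b: "\<bar>\<phi> r\<bar> \<le> 1 + c0 * \<kappa> T" if "r \<in> {0<..T}" for r
    using c0(2)[OF that] mult_left_mono[OF \<kappa>_mono[of r T] c0(1)] that by auto
  have cont: "continuous_on {0<..T} (K (\<lambda>r. \<phi> r - tr n r))" for n
  proof -
    obtain c where c: "c \<ge> 0" "\<And>r. r \<in> {0<..T} \<Longrightarrow> \<bar>\<phi> r\<bar> \<le> e n + c * \<kappa> r"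
      using bound_eps_\<kappa>[OF \<phi> e] by blast
    \<comment> \<open>The remainder is the part of |\<phi>| in excess of \<open>e n\<close>, and the
      bound e n + c \<kappa> leaves at most c \<kappa> for it.\<close>
    have "\<bar>\<phi> r - tr n r\<bar> \<le> c * \<kappa> r" if "r \<in> {0<..T}" for r
      using c(2)[OF that] mult_nonneg_nonneg[OF c(1) \<kappa>_nonneg[of r]] e[of n]
      unfolding tr_def by linarith
    hence "continuous_on {0..T} (K (\<lambda>r. \<phi> r - tr n r))"
      by (intro K_continuous_\<kappa>[OF _ _ c(1)] continuous_intros \<phi>' tr)
    thus ?thesis by (rule continuous_on_subset) auto
  qed
  have bd: "\<bar>K (\<lambda>r. \<phi> r - tr n r) x - K \<phi> x\<bar> \<le> e n" if x: "x \<in> {0<..T}" for n x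
  proof -
    have "K \<phi> x - K (tr n) x = K (\<lambda>r. \<phi> r - tr n r) x"
      by (rule K_diff[OF \<phi>' \<phi>b tr]) (use x in auto)
    moreover have "\<bar>K (tr n) x\<bar> \<le> e n + 0 * q * \<kappa> x"
      using tr by (intro K_bound x) auto
    ultimately show ?thesis by auto
  qed
  have "uniform_limit {0<..T} (\<lambda>n. K (\<lambda>r. \<phi> r - tr n r)) (K \<phi>) sequentially"
  proof (rule uniform_limitI)
    fix \<epsilon> :: real assume "\<epsilon> > 0"
    have "eventually (\<lambda>n. e n < \<epsilon>) sequentially"
      using order_tendstoD(2)[OF LIMSEQ_inverse_real_of_nat \<open>\<epsilon> > 0\<close>] by (simp add: e_def)
    thus "eventually (\<lambda>n. \<forall>x\<in>{0<..T}. dist (K (\<lambda>r. \<phi> r - tr n r) x) (K \<phi> x) < \<epsilon>) sequentially"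
      by eventually_elim (auto simp: dist_real_def intro: le_less_trans[OF bd])
  qed
  thus ?thesis
    by (rule uniform_limit_theorem[OF always_eventually[OF allI[OF cont]] _ sequentially_bot])
qed

text \<open>The constant c depends on e and may grow as e tends to 0. This is harmless because n
  tends to infinity first, with e fixed.\<close>

lemma K_fixed_point_zero:
  assumes \<phi>: "continuous_on {0..T} \<phi>" "\<phi> 0 = 0" and fp: "\<And>x. x \<in> {0<..T} \<Longrightarrow> K \<phi> x = \<phi> x"
    and x: "x \<in> {0<..T}"
  shows "\<phi> x = 0"
proof -
  have \<phi>': "continuous_on {0<..T} \<phi>" using \<phi>(1) by (rule continuous_on_subset) auto
  have "\<bar>\<phi> x\<bar> \<le> e" if e: "e > 0" for e
  proof -
    obtain c where c: "c \<ge> 0" "\<And>r. r \<in> {0<..T} \<Longrightarrow> \<bar>\<phi> r\<bar> \<le> e + c * \<kappa> r"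
      using bound_eps_\<kappa>[OF \<phi> e] by blast
    have it: "\<forall>r\<in>{0<..T}. \<bar>\<phi> r\<bar> \<le> e + c * q ^ n * \<kappa> r" for n
    proof (induction n)
      case (Suc n)
      show ?case
      proof
        fix r assume r: "r \<in> {0<..T}"
        have "\<bar>K \<phi> r\<bar> \<le> e + c * q ^ n * q * \<kappa> r"
          using Suc c(1) q(1) by (intro K_bound[OF \<phi>' _ _ r]) auto
        thus "\<bar>\<phi> r\<bar> \<le> e + c * q ^ Suc n * \<kappa> r" by (simp add: fp[OF r] mult_ac)
      qed
    qed (use c in auto)
    have "(\<lambda>n. e + c * q ^ n * \<kappa> x) \<longlonglongrightarrow> e + c * 0 * \<kappa> x"
      using q by (intro tendsto_intros LIMSEQ_power_zero) auto
    hence "(\<lambda>n. e + c * q ^ n * \<kappa> x) \<longlonglongrightarrow> e" by simp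
    thus ?thesis by (rule LIMSEQ_le_const) (use it x in auto)
  qed
  hence "\<bar>\<phi> x\<bar> \<le> 0" by (rule field_le_epsilon[of "\<bar>\<phi> x\<bar>" 0]) simp
  thus ?thesis by simp
qed

section \<open>Uniqueness for the homogeneous equation\<close>

lemma A_mult_bounded:
  assumes v: "continuous_on {0<..T} v" "\<And>r. r \<in> {0<..T} \<Longrightarrow> \<bar>v r\<bar> \<le> M" and "x \<le> T"
  shows "set_integrable lborel {0<..<x} (\<lambda>t. A t * v t)"
  using assms by (intro set_integrable_mult_bounded[where C = M, OF A_int set_measurable_Ioc]) auto

text \<open>
  Convolving \<open>A * v = 1 * (A v)\<close> with \<open>k\<close> and cancelling by the Sonine identity gives
  \<open>1 * v = 1 * K v\<close>, so \<open>v\<close> is a fixed point of \<open>K\<close>.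
\<close>

lemma censored_homogeneous_zero:
  assumes v: "continuous_on {0..T} v" "v 0 = 0"
    and der: "\<And>x. x \<in> {0<..T} \<Longrightarrow> (convolution A v has_real_derivative A x * v x) (at x within {0<..T})"
    and x: "x \<in> {0<..T}"
  shows "v x = 0"
proof -
  have v': "continuous_on {0<..T} v" using v(1) by (rule continuous_on_subset) auto
  obtain M where M: "\<And>r. r \<in> {0..T} \<Longrightarrow> \<bar>v r\<bar> \<le> M"
    using compact_imp_bounded[OF compact_continuous_image[OF v(1) compact_Icc]]
    unfolding bounded_iff by (metis imageI real_norm_def)
  have vb: "\<bar>v r\<bar> \<le> M" if "r \<in> {0<..T}" for r using M[of r] that by auto
  define p where "p = (\<lambda>t. A t * v t)"
  have pint: "set_integrable lborel {0<..<x} p" if "x \<le> T" for x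
    unfolding p_def using v' vb that by (rule A_mult_bounded)
  have pcont: "continuous_on {0<..T} p" unfolding p_def by (intro continuous_intros A_continuous_Ioc v')
  define P where "P = (\<lambda>y. LBINT t:{0<..<y}. p t)"
  have P1: "P = convolution (\<lambda>_. 1) p" by (simp add: P_def convolution_def[abs_def])
  have "((\<lambda>y. convolution A v y - P y) has_real_derivative 0) (at y within {0<..T})" if y: "y \<in> {0<..T}" for y
    using DERIV_diff[OF der[OF y] LBINT_Ioo_has_real_derivative[OF pcont pint[OF order.refl] y]]
    by (simp add: P_def p_def)
  \<comment> \<open>Equal derivatives give A * v = P only up to a constant. Both sides are at most M
    times the integral of A over (0, y), which tends to 0 with y, and this forces C = 0.\<close>
  then obtain C where C: "\<And>y. y \<in> {0<..T} \<Longrightarrow> convolution A v y - P y = C"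
    using has_field_derivative_zero_constant[of "{0<..T}" "\<lambda>y. convolution A v y - P y"] by auto
  define \<alpha> where "\<alpha> y = (LBINT t:{0<..<y}. A t)" for y
  have "continuous_on {0..T} \<alpha>"
    using convolution_continuous_on[of T "\<lambda>_. 1" 1 A] A_int[of T]
    by (simp add: \<alpha>_def[abs_def] convolution_def[abs_def])
  moreover have "\<alpha> 0 = 0" by (simp add: \<alpha>_def set_lebesgue_integral_def)
  ultimately have "(\<alpha> \<longlongrightarrow> 0) (at 0 within {0..T})"
    using T_pos unfolding continuous_on_def by (metis atLeastAtMost_iff less_imp_le order.refl)
  hence \<alpha>0: "((\<lambda>y. 2 * M * \<alpha> y) \<longlongrightarrow> 2 * M * 0) (at 0 within {0..T})"
    by (intro tendsto_intros)
  have Cle: "\<bar>C\<bar> \<le> 2 * M * \<alpha> y" if y: "y \<in> {0<..T}" for y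
  proof -
    have "\<bar>convolution v A y\<bar> \<le> M * \<alpha> y"
      unfolding \<alpha>_def using y A_nonneg vb
      by (intro abs_convolution_le(2)[OF set_measurable_Ioc[OF v'] _ A_int]) auto
    moreover have "\<bar>P y\<bar> \<le> (LBINT t:{0<..<y}. M * A t)"
      unfolding P_def set_lebesgue_integral_def
    proof (rule integral_abs_bound_integral)
      show "integrable lborel (\<lambda>t. indicator {0<..<y} t *\<^sub>R p t)"
        using pint[of y] y by (simp add: set_integrable_def)
      show "integrable lborel (\<lambda>t. indicator {0<..<y} t *\<^sub>R (M * A t))"
        unfolding set_integrable_def[symmetric] by (intro set_integrable_mult_right A_int)
      show "\<bar>indicator {0<..<y} t *\<^sub>R p t\<bar> \<le> indicator {0<..<y} t *\<^sub>R (M * A t)" for t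
      proof (cases "t \<in> {0<..<y}")
        case True
        hence "\<bar>v t\<bar> * A t \<le> M * A t" using vb[of t] A_nonneg[of t] y by (intro mult_right_mono) auto
        thus ?thesis using True A_nonneg[of t] by (simp add: p_def abs_mult mult.commute)
      qed simp
    qed
    ultimately show ?thesis using C[OF y] by (simp add: convolution_commute[of A v] \<alpha>_def)
  qed
  have "C = 0"
  proof (rule ccontr)
    assume "C \<noteq> 0"
    hence "eventually (\<lambda>y. 2 * M * \<alpha> y < \<bar>C\<bar>) (at 0 within {0..T})"
      using order_tendstoD(2)[OF \<alpha>0, of "\<bar>C\<bar>"] by simp
    then obtain d where d: "d > 0" "\<And>y. y \<in> {0..T} \<Longrightarrow> y \<noteq> 0 \<Longrightarrow> dist y 0 < d \<Longrightarrow> 2 * M * \<alpha> y < \<bar>C\<bar>"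
      unfolding eventually_at by blast
    define y where "y = min (d / 2) T"
    have "y \<in> {0<..T}" using d(1) T_pos by (auto simp: y_def)
    moreover have "y < d" using d(1) unfolding y_def by linarith
    ultimately have "2 * M * \<alpha> y < \<bar>C\<bar>" by (intro d(2)) auto
    thus False using Cle[OF \<open>y \<in> {0<..T}\<close>] by linarith
  qed
  hence VP: "convolution A v y = P y" if "y \<in> {0<..T}" for y using C[OF that] by linarith
  have main: "(LBINT t:{0<..<y}. v t) = (LBINT t:{0<..<y}. K v t)" if y: "y \<in> {0<..T}" for y
  proof -
    have vint: "set_integrable lborel {0<..<y} v"
    proof -
      have "set_integrable lborel {0..T} v" using v(1) by (rule borel_integrable_atLeastAtMost')
      thus ?thesis by (rule set_integrable_subset) (use y in auto)
    qed
    have abs_kA: "(LBINT t:{0<..<y - s}. \<bar>k (y - s - t) * A t\<bar>) = 1" if "s \<in> {0<..<y}" for s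
    proof -
      have "(LBINT t:{0<..<y - s}. \<bar>k (y - s - t) * A t\<bar>) = convolution k A (y - s)"
        unfolding convolution_def using k_nonneg A_nonneg by (intro set_lebesgue_integral_cong) auto
      thus ?thesis using that convolution_k_A[of "y - s"] by simp
    qed
    have b1: "(LBINT t:{0<..<y - s}. \<bar>1 * k t\<bar>) \<le> \<kappa> y" if "s \<in> {0<..<y}" for s
    proof -
      have "(LBINT t:{0<..<y - s}. \<bar>1 * k t\<bar>) = \<kappa> (y - s)"
        unfolding \<kappa>_def using k_nonneg by (intro set_lebesgue_integral_cong) auto
      also have "\<dots> \<le> \<kappa> y" using that by (intro \<kappa>_mono) auto
      finally show ?thesis .
    qed
    have b1': "(LBINT t:{0<..<y - s}. \<bar>k (y - s - t) * 1\<bar>) \<le> \<kappa> y" if "s \<in> {0<..<y}" for s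
      using convolution_commute[of "\<lambda>t. \<bar>k t\<bar>" "\<lambda>_. 1" "y - s"] b1[OF that] by (simp add: convolution_def)
    have k1: "set_integrable lborel {0<..<y - s} (\<lambda>t. 1 * k t)" for s
      using k_int by simp
    have k1': "set_integrable lborel {0<..<y - s} (\<lambda>t. k (y - s - t) * 1)" for s
      using k1 by (subst convolution_integrable_commute)
    have py: "set_integrable lborel {0<..<y} p" using y by (intro pint) auto
    have m1: "set_borel_measurable lborel {0<..<y} (\<lambda>_. 1 :: real)" unfolding set_borel_measurable_def by simp
    have "(LBINT t:{0<..<y}. v t) = convolution (\<lambda>_. 1) v y" by (simp add: convolution_def)
    also have "\<dots> = convolution (convolution k A) v y"
      by (intro convolution_cong) (auto simp: convolution_k_A)
    also have "\<dots> = convolution k (convolution A v) y"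
      by (rule convolution_assoc[symmetric, OF k_measurable A_measurable kernel_integrable eq_refl[OF abs_kA] vint])
    also have "\<dots> = convolution k P y"
      using y by (intro convolution_cong VP) auto
    also have "\<dots> = convolution (convolution k (\<lambda>_. 1)) p y"
      unfolding P1
      by (rule convolution_assoc[OF k_measurable m1 k1' b1' py])
    also have "convolution k (\<lambda>_. 1) = convolution (\<lambda>_. 1) k"
      by (intro ext convolution_commute)
    also have "convolution (convolution (\<lambda>_. 1) k) p y = convolution (\<lambda>_. 1) (convolution k p) y"
      by (rule convolution_assoc[symmetric, OF m1 k_measurable k1 b1 py])
    also have "\<dots> = (LBINT t:{0<..<y}. K v t)" by (simp add: convolution_def[of "\<lambda>_. 1"] K_def p_def)
    finally show ?thesis .
  qed
  have Kb: "\<bar>K v y\<bar> \<le> M" if "y \<in> {0<..T}" for y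
    using K_bound[OF v', of M 0 y] vb that by simp
  have Kc: "continuous_on {0<..T} (K v)" using v by (rule K_continuous)
  have Ki: "set_integrable lborel {0<..<T} (K v)"
  proof -
    have "set_integrable lborel {0<..<T} (\<lambda>_. 1 :: real)"
      by (rule set_integrable_subset[OF borel_integrable_atLeastAtMost'[of 0 T]]) auto
    hence "set_integrable lborel {0<..<T} (\<lambda>t. 1 * K v t)"
      by (rule set_integrable_mult_bounded[OF _ set_measurable_Ioc[OF Kc order.refl] Kb]) auto
    thus ?thesis by simp
  qed
  have vi: "set_integrable lborel {0<..<T} v"
    by (rule set_integrable_subset[OF borel_integrable_atLeastAtMost'[OF v(1)]]) auto
  \<comment> \<open>The integrals of v and K v agree up to every y. Since both functions are
    continuous on (0, T], differentiation yields equality at every point, not merely almost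
    everywhere.\<close>
  have "K v y = v y" if y: "y \<in> {0<..T}" for y
  proof -
    have "((\<lambda>y. LBINT t:{0<..<y}. v t) has_real_derivative K v y) (at y within {0<..T})"
      by (rule has_field_derivative_transform_within[OF LBINT_Ioo_has_real_derivative[OF Kc Ki y] zero_less_one y])
         (simp add: main)
    thus ?thesis
      using vector_derivative_unique_within[OF at_within_Ioc_neq_bot[OF y]]
        LBINT_Ioo_has_real_derivative[OF v' vi y]
      unfolding has_real_derivative_iff_has_vector_derivative by blast
  qed
  from K_fixed_point_zero[OF v this x] show ?thesis .
qed

end

section \<open>The series solution\<close>

context sonine_contraction
begin

lemma K_op_eq: "K_op A k \<phi> x = (if x = 0 then \<phi> 0 else K \<phi> x)"
  by (simp add: K_op_def K_def convolution_def mult_ac)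

lemma RL_integral_eq: "RL_integral k g = convolution g k"
  by (simp add: RL_integral_def[abs_def] convolution_def[abs_def])

text \<open>The claims support each other in the induction: the weighted bound makes the next
  iterate continuous, and the value 0 at 0 lets \<open>K_op\<close> be replaced by \<open>K\<close>.
  The start is |k * g| \<le> G \<kappa>.\<close>

lemma K_op_iterates:
  assumes g: "continuous_on {0..T} g" "\<And>x. x \<in> {0..T} \<Longrightarrow> \<bar>g x\<bar> \<le> G"
  shows "continuous_on {0..T} ((K_op A k ^^ n) (RL_integral k g)) \<and>
    (K_op A k ^^ n) (RL_integral k g) 0 = 0 \<and>
    (\<forall>x\<in>{0<..T}. \<bar>(K_op A k ^^ n) (RL_integral k g) x\<bar> \<le> G * q ^ n * \<kappa> x)"
proof (induction n)
  case 0
  have g': "continuous_on {0<..T} g" using g(1) by (rule continuous_on_subset) auto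
  have "continuous_on {0..T} (convolution g k)"
    using g(2) by (intro convolution_continuous_on[where C = G, OF g' _ k_int]) auto
  moreover have "convolution g k 0 = 0" by (simp add: convolution_def set_lebesgue_integral_def)
  moreover have "\<bar>convolution g k x\<bar> \<le> G * \<kappa> x" if "x \<in> {0<..T}" for x
    unfolding \<kappa>_def using that k_nonneg g(2)
    by (intro abs_convolution_le(2)[OF set_measurable_Ioc[OF g'] _ k_int]) auto
  ultimately show ?case by (simp add: RL_integral_eq)
next
  case (Suc n)
  let ?u = "(K_op A k ^^ n) (RL_integral k g)"
  have u: "continuous_on {0<..T} ?u"
    by (rule continuous_on_subset[OF conjunct1[OF Suc]]) auto
  have "G \<ge> 0" using g(2)[of 0] T_pos by auto
  hence c: "G * q ^ n \<ge> 0" using q by simp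
  have b: "\<bar>?u x\<bar> \<le> G * q ^ n * \<kappa> x" if "x \<in> {0<..T}" for x using Suc that by blast
  have K0: "K ?u 0 = 0" by (simp add: K_def convolution_def set_lebesgue_integral_def)
  have eq: "K_op A k ?u = K ?u"
  proof
    fix x
    show "K_op A k ?u x = K ?u x"
      using K0 conjunct1[OF conjunct2[OF Suc]] K_op_eq[of ?u x] by (cases "x = 0") auto
  qed
  have "continuous_on {0..T} (K ?u)" using u b c by (rule K_continuous_\<kappa>)
  moreover have "\<bar>K ?u x\<bar> \<le> G * q ^ Suc n * \<kappa> x" if "x \<in> {0<..T}" for x
    using K_bound[of ?u 0 "G * q ^ n" x] u b c that by (simp add: mult_ac)
  ultimately show ?case using K0 by (simp add: eq)
qed

text \<open>The majorant G q ^ n \<kappa> serves three purposes: uniform convergence by the M-test,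
  the bound |u| \<le> G / (1 - q) \<kappa> that keeps A u bounded, and the interchange of
  \<open>K\<close> with the sum. The interchange turns the series without its first term into K u,
  whence u = k * g + K u.\<close>

lemma censored_integral_properties:
  assumes g: "continuous_on {0..T} g"
  defines "u \<equiv> censored_integral A k g"
  shows "x \<in> {0..T} \<Longrightarrow> summable (\<lambda>i. (K_op A k ^^ i) (RL_integral k g) x)"
    and "continuous_on {0..T} u" and "u 0 = 0"
    and "\<exists>C. \<forall>x\<in>{0<..T}. \<bar>A x * u x\<bar> \<le> C"
    and "x \<in> {0<..T} \<Longrightarrow> u x = convolution k (\<lambda>t. g t + A t * u t) x"
proof -
  obtain G where G: "\<And>r. r \<in> {0..T} \<Longrightarrow> \<bar>g r\<bar> \<le> G"
    using compact_imp_bounded[OF compact_continuous_image[OF g(1) compact_Icc]]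
    unfolding bounded_iff by (metis imageI real_norm_def)
  have G0: "G \<ge> 0" using G[of 0] T_pos by auto
  define un where "un n = (K_op A k ^^ n) (RL_integral k g)" for n
  have un: "continuous_on {0..T} (un n)" "un n 0 = 0"
     "\<And>x. x \<in> {0<..T} \<Longrightarrow> \<bar>un n x\<bar> \<le> G * q ^ n * \<kappa> x" for n
    using K_op_iterates[OF g G] unfolding un_def by blast+
  have un': "continuous_on {0<..T} (un n)" for n using un(1) by (rule continuous_on_subset) auto
  have un_Suc: "un (Suc n) x = K (un n) x" if "x \<noteq> 0" for n x
    using that by (simp add: un_def K_op_eq)
  have u: "u = (\<lambda>x. \<Sum>i. un i x)" by (simp add: u_def un_def censored_integral_def[abs_def])
  have geo: "summable (\<lambda>n. G * q ^ n * c)" "(\<Sum>n. G * q ^ n * c) = G / (1 - q) * c" for c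
    using sums_mult2[OF sums_mult[OF geometric_sums[of q], of G], of c] q
    by (auto simp: sums_iff)
  have sn: "summable (\<lambda>i. \<bar>un i x\<bar>)" if "x \<in> {0..T}" for x
  proof (cases "x = 0")
    case False
    with that have "x \<in> {0<..T}" by auto
    thus ?thesis using un(3) by (intro summable_comparison_test'[OF geo(1)[of "\<kappa> x"]]) auto
  qed (simp add: un)
  show sm: "summable (\<lambda>i. (K_op A k ^^ i) (RL_integral k g) x)" if "x \<in> {0..T}" for x
    using summable_rabs_cancel[OF sn[OF that]] by (simp add: un_def)
  have unb: "norm (un n x) \<le> G * q ^ n * \<kappa> T" if "x \<in> {0..T}" for n x
  proof (cases "x = 0")
    case True
    thus ?thesis using G0 q \<kappa>_nonneg by (simp add: un)
  next
    case False
    hence "\<bar>un n x\<bar> \<le> G * q ^ n * \<kappa> x" using that by (intro un) auto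
    also have "\<dots> \<le> G * q ^ n * \<kappa> T" using that G0 q by (intro mult_left_mono \<kappa>_mono) auto
    finally show ?thesis by simp
  qed
  have ul: "uniform_limit {0..T} (\<lambda>n x. \<Sum>i<n. un i x) u sequentially"
    unfolding u using unb geo(1) by (rule Weierstrass_m_test)
  have "continuous_on {0..T} (\<lambda>x. \<Sum>i<n. un i x)" for n
    by (intro continuous_intros un)
  thus uc: "continuous_on {0..T} u"
    using uniform_limit_theorem[OF _ ul sequentially_bot] by (simp add: always_eventually)
  show "u 0 = 0" by (simp add: u un)
  define c where "c = G / (1 - q)"
  have c: "c \<ge> 0" using G0 q by (simp add: c_def)
  have ub: "\<bar>u x\<bar> \<le> c * \<kappa> x" if "x \<in> {0<..T}" for x
    using norm_suminf_le[of "\<lambda>n. un n x" "\<lambda>n. G * q ^ n * \<kappa> x", OF _ geo(1)] un(3)[OF that]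
    by (simp add: u geo(2) c_def)
  have "\<bar>A x * u x\<bar> \<le> c * q" if "x \<in> {0<..T}" for x
    using ub[OF that] c that by (rule bounded_by_\<kappa>_mult_A)
  thus "\<exists>C. \<forall>x\<in>{0<..T}. \<bar>A x * u x\<bar> \<le> C" by blast
  show "u x = convolution k (\<lambda>t. g t + A t * u t) x" if x: "x \<in> {0<..T}"
  proof -
    let ?f = "\<lambda>n r. indicator {0<..<x} r *\<^sub>R (k (x - r) * (A r * un n r))"
    have kx: "set_integrable lborel {0<..<x} (\<lambda>r. k (x - r) * 1)"
      using convolution_integrable_commute[of x k "\<lambda>_. 1"] k_int[of x] by simp
    have kx2: "(LBINT r:{0<..<x}. k (x - r)) = \<kappa> x"
      using convolution_commute[of k "\<lambda>_. 1" x] by (simp add: convolution_def \<kappa>_def)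
    have fi: "integrable lborel (?f n)" for n
      using K_integrable[OF un', of n "G * q ^ n * \<kappa> T" x] unb[of _ n] x by (auto simp: set_integrable_def)
    have fb: "norm (?f n r) \<le> G * q ^ n * (indicator {0<..<x} r *\<^sub>R k (x - r))" for n r
    proof (cases "r \<in> {0<..<x}")
      case True
      hence r: "r \<in> {0<..T}" using x by auto
      have "\<bar>A r * un n r\<bar> \<le> G * q ^ n * q"
        using un(3)[OF r] G0 q r by (intro bounded_by_\<kappa>_mult_A) auto
      \<comment> \<open>The additional factor q is given away; the majorant is summable in n without
        it.\<close>
      also have "\<dots> \<le> G * q ^ n" using G0 q by (intro mult_left_le) auto
      finally have "k (x - r) * \<bar>A r * un n r\<bar> \<le> k (x - r) * (G * q ^ n)"
        using True k_nonneg[of "x - r"] by (intro mult_left_mono) auto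
      thus ?thesis using True k_nonneg[of "x - r"] by (simp add: abs_mult mult_ac)
    qed simp
    have nf: "(LINT r|lborel. norm (?f n r)) \<le> G * q ^ n * \<kappa> x" for n
    proof -
      have "(LINT r|lborel. norm (?f n r)) \<le> (LINT r|lborel. G * q ^ n * (indicator {0<..<x} r *\<^sub>R k (x - r)))"
        using fi[THEN integrable_norm] kx fb by (intro integral_mono) (auto simp: set_integrable_def)
      also have "\<dots> = G * q ^ n * \<kappa> x"
        using kx2 by (simp add: set_lebesgue_integral_def)
      finally show ?thesis .
    qed
    have "(\<Sum>n. K (un n) x) = (LINT r|lborel. (\<Sum>n. ?f n r))"
      unfolding K_def convolution_def set_lebesgue_integral_def
    proof (rule integral_suminf[symmetric])
      show "AE r in lborel. summable (\<lambda>n. norm (?f n r))"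
      proof (rule AE_I2)
        fix r :: real
        have "summable (\<lambda>n. \<bar>indicator {0<..<x} r * (k (x - r) * A r)\<bar> * \<bar>un n r\<bar>)"
        proof (cases "r \<in> {0<..<x}")
          case True
          thus ?thesis using x by (intro summable_mult sn) auto
        qed simp
        thus "summable (\<lambda>n. norm (?f n r))" by (simp add: abs_mult mult_ac)
      qed
      show "summable (\<lambda>n. LINT r|lborel. norm (?f n r))"
        using nf by (intro summable_comparison_test'[OF geo(1)[of "\<kappa> x"]]) auto
    qed (rule fi)
    also have "\<dots> = K u x"
      unfolding K_def convolution_def set_lebesgue_integral_def
    proof (rule Bochner_Integration.integral_cong[OF refl])
      fix r :: real
      show "(\<Sum>n. ?f n r) = indicator {0<..<x} r *\<^sub>R (k (x - r) * (A r * u r))"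
      proof (cases "r \<in> {0<..<x}")
        case True
        hence "summable (\<lambda>n. un n r)" using summable_rabs_cancel[OF sn[of r]] x by auto
        thus ?thesis using True by (simp add: u suminf_mult mult.assoc[symmetric])
      qed simp
    qed
    finally have *: "(\<Sum>n. K (un n) x) = K u x" .
    have "u x = un 0 x + (\<Sum>n. un (Suc n) x)"
      using suminf_split_head[OF summable_rabs_cancel[OF sn[of x]]] x by (simp add: u)
    also have "(\<Sum>n. un (Suc n) x) = K u x" using x by (simp add: un_Suc *)
    also have "un 0 x = convolution k g x"
      by (simp add: un_def RL_integral_eq convolution_commute[of g k])
    also have "convolution k g x + K u x = convolution k (\<lambda>t. g t + A t * u t) x"
    proof -
      have u': "continuous_on {0<..T} u" using uc by (rule continuous_on_subset) auto
      have g': "continuous_on {0<..T} g" using g by (rule continuous_on_subset) auto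
      have "\<bar>u r\<bar> \<le> c * \<kappa> T" if "r \<in> {0<..T}" for r
        using ub[OF that] mult_left_mono[OF \<kappa>_mono[of r T] c] that by auto
      hence 1: "set_integrable lborel {0<..<x} (\<lambda>r. k (x - r) * (A r * u r))"
        using x by (intro K_integrable[OF u']) auto
      have "set_integrable lborel {0<..<x} (\<lambda>r. g (x - r) * k r)"
        using x G k_nonneg by (intro abs_convolution_le(1)[OF set_measurable_Ioc[OF g'] _ k_int, where C = G]) auto
      hence 2: "set_integrable lborel {0<..<x} (\<lambda>r. k (x - r) * g r)"
        by (subst convolution_integrable_commute)
      show ?thesis
        unfolding K_def convolution_def using set_integral_add(2)[OF 2 1] by (simp add: algebra_simps)
    qed
    finally show ?thesis .
  qed
qed

lemma convolution_A_censored_integral_deriv: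
  assumes g: "continuous_on {0..T} g" and x: "x \<in> {0<..T}"
  shows "(convolution A (censored_integral A k g) has_real_derivative
     g x + A x * censored_integral A k g x) (at x within {0<..T})"
proof -
  define u where "u = censored_integral A k g"
  note u = censored_integral_properties[OF g, folded u_def]
  obtain C where C: "\<And>x. x \<in> {0<..T} \<Longrightarrow> \<bar>A x * u x\<bar> \<le> C" using u(4) by blast
  obtain G where G: "\<And>r. r \<in> {0..T} \<Longrightarrow> \<bar>g r\<bar> \<le> G"
    using compact_imp_bounded[OF compact_continuous_image[OF g(1) compact_Icc]]
    unfolding bounded_iff by (metis imageI real_norm_def)
  \<comment> \<open>The right-hand side of the equation. It is bounded because A u is, hence
    integrable, as associativity of the convolution demands.\<close>
  define w where "w = (\<lambda>t. g t + A t * u t)"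
  have w: "continuous_on {0<..T} w"
    unfolding w_def
    by (intro continuous_intros A_continuous_Ioc continuous_on_subset[OF g] continuous_on_subset[OF u(2)]) auto
  have wb: "\<bar>w t\<bar> \<le> G + C" if "t \<in> {0<..T}" for t
    using G[of t] C[OF that] that unfolding w_def by auto
  have wi: "set_integrable lborel {0<..<y} w" if "y \<le> T" for y
  proof -
    have "set_integrable lborel {0<..<y} (\<lambda>_. 1 :: real)"
      by (rule set_integrable_subset[OF borel_integrable_atLeastAtMost'[of 0 y]]) auto
    hence "set_integrable lborel {0<..<y} (\<lambda>t. 1 * w t)"
      using wb that
      by (intro set_integrable_mult_bounded[OF _ set_measurable_Ioc[OF w], where C = "G + C"]) auto
    thus ?thesis by simp
  qed
  have "convolution A u y = (LBINT t:{0<..<y}. w t)" if y: "y \<in> {0<..T}" for y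
  proof -
    have i: "set_integrable lborel {0<..<y - s} (\<lambda>t. A (y - s - t) * k t)" for s
      using kernel_integrable by (subst convolution_integrable_commute)
    have b: "(LBINT t:{0<..<y - s}. \<bar>A (y - s - t) * k t\<bar>) \<le> 1" if "s \<in> {0<..<y}" for s
    proof -
      have "(LBINT t:{0<..<y - s}. \<bar>A (y - s - t) * k t\<bar>) = convolution A k (y - s)"
        unfolding convolution_def using k_nonneg A_nonneg by (intro set_lebesgue_integral_cong) auto
      thus ?thesis using that convolution_k_A[of "y - s"] by (simp add: convolution_commute[of A k])
    qed
    have "convolution A u y = convolution A (convolution k w) y"
      using u(5) y by (intro convolution_cong) (auto simp: w_def)
    also have "\<dots> = convolution (convolution A k) w y"
      by (rule convolution_assoc[OF A_measurable k_measurable i b wi]) (use y in auto)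
    also have "\<dots> = convolution (\<lambda>_. 1) w y"
      by (intro convolution_cong) (auto simp: convolution_commute[of A k] convolution_k_A)
    finally show ?thesis by (simp add: convolution_def)
  qed
  hence "(convolution A u has_real_derivative w x) (at x within {0<..T})"
    by (intro has_field_derivative_transform_within[OF LBINT_Ioo_has_real_derivative[OF w wi x] zero_less_one x])
      auto
  thus ?thesis by (simp add: u_def w_def)
qed

text \<open>\<open>vector_derivative\<close> is a choice operator, so its value is determined only
  by exhibiting a derivative and knowing that derivatives within (0, T] are unique.\<close>

lemma RL_derivative_eqI:
  assumes "(convolution A \<phi> has_real_derivative D) (at x within {0<..T})" "x \<in> {0<..T}"
  shows "RL_derivative A T \<phi> x = D"
proof -
  have "(\<lambda>y. LBINT t:{0<..<y}. \<phi> (y - t) * A t) = convolution A \<phi>"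
    using convolution_commute[of \<phi> A] by (auto simp: convolution_def)
  thus ?thesis unfolding RL_derivative_def
    using assms at_within_Ioc_neq_bot[OF assms(2)]
    by (simp add: vector_derivative_within has_real_derivative_iff_has_vector_derivative)
qed

lemma convolution_A_integrable:
  assumes "continuous_on {0..T} \<phi>" "x \<le> T"
  shows "set_integrable lborel {0<..<x} (\<lambda>t. A (x - t) * \<phi> t)"
proof -
  obtain M where M: "\<And>r. r \<in> {0..T} \<Longrightarrow> \<bar>\<phi> r\<bar> \<le> M"
    using compact_imp_bounded[OF compact_continuous_image[OF assms(1) compact_Icc]]
    unfolding bounded_iff by (metis imageI real_norm_def)
  have "continuous_on {0<..T} \<phi>" using assms(1) by (rule continuous_on_subset) auto
  hence "set_integrable lborel {0<..<x} (\<lambda>t. \<phi> (x - t) * A t)"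
    using M assms A_nonneg by (intro abs_convolution_le(1)[OF set_measurable_Ioc _ A_int, where C = M]) auto
  thus ?thesis by (subst convolution_integrable_commute)
qed

theorem censored_initial_value_problem:
  fixes \<phi>\<^sub>0 :: real
  assumes g: "continuous_on {0..T} g"
  defines "\<phi> \<equiv> \<lambda>x. \<phi>\<^sub>0 + censored_integral A k g x"
  shows "\<phi> \<in> C_closed A T" and "\<phi> 0 = \<phi>\<^sub>0"
    and "x \<in> {0<..T} \<Longrightarrow> censored_derivative A T \<phi> x = g x"
    and "\<psi> \<in> C_closed A T \<Longrightarrow> (\<And>x. x \<in> {0<..T} \<Longrightarrow> censored_derivative A T \<psi> x = g x) \<Longrightarrow>
      \<psi> 0 = \<phi>\<^sub>0 \<Longrightarrow> x \<in> {0..T} \<Longrightarrow> \<psi> x = \<phi> x"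
proof -
  note u = censored_integral_properties[OF g]
  have \<phi>c: "continuous_on {0..T} \<phi>" unfolding \<phi>_def by (intro continuous_intros u)
  have \<phi>c': "continuous_on {0<..T} \<phi>" using \<phi>c by (rule continuous_on_subset) auto
  have conv: "convolution A \<phi> y = \<phi>\<^sub>0 * (LBINT t:{0<..<y}. A t) + convolution A (censored_integral A k g) y"
    if "y \<in> {0<..T}" for y
  proof -
    have "convolution A \<phi> y = convolution A (\<lambda>_. \<phi>\<^sub>0) y + convolution A (censored_integral A k g) y"
      unfolding convolution_def \<phi>_def
      using that set_integral_add(2)[OF convolution_A_integrable[of "\<lambda>_. \<phi>\<^sub>0" y] convolution_A_integrable[OF u(2), of y]]
      by (simp add: algebra_simps)
    also have "convolution A (\<lambda>_. \<phi>\<^sub>0) y = \<phi>\<^sub>0 * (LBINT t:{0<..<y}. A t)"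
      by (subst convolution_commute) (simp add: convolution_def)
    finally show ?thesis .
  qed
  have der: "(convolution A \<phi> has_real_derivative A y * \<phi> y + g y) (at y within {0<..T})" if y: "y \<in> {0<..T}" for y
  proof (rule has_field_derivative_transform_within[OF _ zero_less_one y])
    show "((\<lambda>y. \<phi>\<^sub>0 * (LBINT t:{0<..<y}. A t) + convolution A (censored_integral A k g) y)
        has_real_derivative A y * \<phi> y + g y) (at y within {0<..T})"
      using DERIV_add[OF DERIV_cmult[OF LBINT_Ioo_has_real_derivative[OF A_continuous_Ioc A_int y], of \<phi>\<^sub>0]
          convolution_A_censored_integral_deriv[OF g y]]
      by (simp add: \<phi>_def algebra_simps)
  qed (simp add: conv)
  have "set_integrable lborel {0<..<T} \<phi>"
    by (rule set_integrable_subset[OF borel_integrable_atLeastAtMost'[OF \<phi>c]]) auto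
  moreover have "continuous_on {0<..T} (\<lambda>y. A y * \<phi> y + g y)"
    by (intro continuous_intros A_continuous_Ioc \<phi>c' continuous_on_subset[OF g]) auto
  ultimately show \<phi>: "\<phi> \<in> C_closed A T"
    unfolding C_closed_def C_left_open_def C1_left_open_def using \<phi>c \<phi>c' der by auto
  show \<phi>0: "\<phi> 0 = \<phi>\<^sub>0" by (simp add: \<phi>_def u)
  show "censored_derivative A T \<phi> x = g x" if "x \<in> {0<..T}"
    using RL_derivative_eqI[OF der[OF that] that] by (simp add: censored_derivative_def)
  show "\<psi> x = \<phi> x" if \<psi>: "\<psi> \<in> C_closed A T" "\<And>x. x \<in> {0<..T} \<Longrightarrow> censored_derivative A T \<psi> x = g x"
    "\<psi> 0 = \<phi>\<^sub>0" and x: "x \<in> {0..T}"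
  proof (cases "x = 0")
    case False
    hence x': "x \<in> {0<..T}" using x by auto
    have \<psi>c: "continuous_on {0..T} \<psi>" using \<psi>(1) by (simp add: C_closed_def)
    have der\<psi>: "(convolution A \<psi> has_real_derivative A y * \<psi> y + g y) (at y within {0<..T})" if y: "y \<in> {0<..T}" for y
    proof -
      \<comment> \<open>Membership in \<open>C_closed\<close> provides a genuine derivative; the
        equation for \<open>RL_derivative\<close> then identifies its value.\<close>
      obtain D where D: "(convolution A \<psi> has_real_derivative D) (at y within {0<..T})"
        using \<psi>(1) y unfolding C_closed_def C_left_open_def C1_left_open_def by blast
      have "D = A y * \<psi> y + g y"
        using \<psi>(2)[OF y] RL_derivative_eqI[OF D y] by (simp add: censored_derivative_def algebra_simps)
      thus ?thesis using D by simp
    qed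
    have "\<psi> x - \<phi> x = 0"
    proof (rule censored_homogeneous_zero[OF _ _ _ x'])
      show "continuous_on {0..T} (\<lambda>x. \<psi> x - \<phi> x)" by (intro continuous_intros \<psi>c \<phi>c)
      show "\<psi> 0 - \<phi> 0 = 0" by (simp add: \<psi> \<phi>0)
      fix y assume y: "y \<in> {0<..T}"
      have eq: "convolution A \<psi> z - convolution A \<phi> z = convolution A (\<lambda>x. \<psi> x - \<phi> x) z" if "z \<in> {0<..T}" for z
        unfolding convolution_def
        using that set_integral_diff(2)[OF convolution_A_integrable[OF \<psi>c, of z] convolution_A_integrable[OF \<phi>c, of z]]
        by (simp add: algebra_simps)
      have "((\<lambda>z. convolution A \<psi> z - convolution A \<phi> z) has_real_derivative A y * (\<psi> y - \<phi> y)) (at y within {0<..T})"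
        using DERIV_diff[OF der\<psi>[OF y] der[OF y]] by (simp add: algebra_simps)
      thus "(convolution A (\<lambda>x. \<psi> x - \<phi> x) has_real_derivative A y * (\<psi> y - \<phi> y)) (at y within {0<..T})"
        by (rule has_field_derivative_transform_within[OF _ zero_less_one y]) (rule eq)
    qed
    thus ?thesis by simp
  qed (simp add: \<psi> \<phi>0)
qed

end

section \<open>Bernstein functions\<close>

text \<open>On (0, y) the weight exp (- l x) is at least exp (- l y), so h is dominated there by exp
  (l y) times the integrand of a finite transform.\<close>

lemma set_integrable_Ioo_Laplace:
  fixes h :: "real \<Rightarrow> real"
  assumes anti: "antimono_on {0<..} h" and nn: "\<And>x. x > 0 \<Longrightarrow> h x \<ge> 0"
    and fin: "(\<integral>\<^sup>+ x. indicator {0<..} x * ennreal (exp (- l * x) * h x) \<partial>lborel) < \<infinity>" and l: "l > 0"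
  shows "set_integrable lborel {0<..<y} h"
proof -
  have hm [measurable]: "(\<lambda>x. indicator {0<..} x * h x) \<in> borel_measurable borel"
    using anti by (rule antimono_on_borel_measurable)
  have "integrable lborel (\<lambda>x. exp (- l * x) * (indicator {0<..} x * h x))"
  proof (rule integrableI_nonneg)
    show "AE x in lborel. 0 \<le> exp (- l * x) * (indicator {0<..} x * h x)"
      using nn by (auto simp: indicator_def)
    have "(\<integral>\<^sup>+ x. ennreal (exp (- l * x) * (indicator {0<..} x * h x)) \<partial>lborel)
        = (\<integral>\<^sup>+ x. indicator {0<..} x * ennreal (exp (- l * x) * h x) \<partial>lborel)"
      by (intro nn_integral_cong) (auto simp: indicator_def)
    thus "(\<integral>\<^sup>+ x. ennreal (exp (- l * x) * (indicator {0<..} x * h x)) \<partial>lborel) < \<infinity>"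
      using fin by simp
  qed measurable
  hence i: "integrable lborel (\<lambda>x. exp (l * y) * (exp (- l * x) * (indicator {0<..} x * h x)))"
    by (rule integrable_mult_right)
  show ?thesis unfolding set_integrable_def
  proof (rule Bochner_Integration.integrable_bound[OF i])
    have "(\<lambda>x. indicator {0<..<y} x * (indicator {0<..} x * h x)) \<in> borel_measurable lborel" by measurable
    also have "(\<lambda>x. indicator {0<..<y} x * (indicator {0<..} x * h x)) = (\<lambda>x. indicator {0<..<y} x *\<^sub>R h x)"
      by (auto simp: indicator_def)
    finally show "(\<lambda>x. indicator {0<..<y} x *\<^sub>R h x) \<in> borel_measurable lborel" .
    show "AE x in lborel. norm (indicator {0<..<y} x *\<^sub>R h x)
        \<le> norm (exp (l * y) * (exp (- l * x) * (indicator {0<..} x * h x)))"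
    proof (rule AE_I2)
      fix x
      show "norm (indicator {0<..<y} x *\<^sub>R h x)
        \<le> norm (exp (l * y) * (exp (- l * x) * (indicator {0<..} x * h x)))"
      proof (cases "x \<in> {0<..<y}")
        case True
        hence "1 \<le> exp (l * y - l * x)" using l by simp
        hence "1 * \<bar>h x\<bar> \<le> exp (l * y - l * x) * \<bar>h x\<bar>" by (intro mult_right_mono) auto
        thus ?thesis using True by (simp add: abs_mult exp_diff exp_minus field_simps)
      qed simp
    qed
  qed
qed

lemma bernstein_triplet_ge:
  assumes "bernstein_triplet f a b \<mu>" "x > 0"
  shows "a \<le> f x" "b \<le> f x / x"
proof -
  interpret levy_measure \<mu>
    using assms(1) unfolding bernstein_triplet_def levy_measure_def by blast
  have ab: "a \<ge> 0" "b \<ge> 0" and f: "f x = a + b * x + (\<integral> t. (1 - exp (- x * t)) \<partial>\<mu>)"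
    using assms unfolding bernstein_triplet_def by blast+
  have i: "(\<integral> t. (1 - exp (- x * t)) \<partial>\<mu>) \<ge> 0" using assms(2) by (rule one_minus_exp_integral_nonneg)
  have bx: "b * x \<ge> 0" using ab assms(2) by simp
  show "a \<le> f x" using f i bx by linarith
  have "b * x \<le> f x" using f i ab by linarith
  thus "b \<le> f x / x" using assms(2) by (simp add: field_simps)
qed

text \<open>All three terms of the representation are nonnegative, so a \<le> f x and b \<le> f x /
  x; the limits at 0 and at infinity force both to be 0. The lemma is meant for f and for its
  conjugate alike.\<close>

lemma bernstein_triplet_no_drift:
  assumes f: "bernstein_triplet f a b \<mu>"
    and 0: "(f \<longlongrightarrow> 0) (at_right 0)" and inf: "((\<lambda>x. f x / x) \<longlongrightarrow> 0) at_top"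
    and l: "l > 0"
  shows "f l = (\<integral> t. (1 - exp (- l * t)) \<partial>\<mu>)"
proof -
  have "eventually (\<lambda>x. a \<le> f x) (at_right 0)"
    using eventually_at_right_less[of 0] by eventually_elim (rule bernstein_triplet_ge[OF f])
  hence "a \<le> 0" by (rule tendsto_lowerbound[OF 0]) simp
  moreover have "eventually (\<lambda>x. b \<le> f x / x) at_top"
    using eventually_gt_at_top[of 0] by eventually_elim (rule bernstein_triplet_ge[OF f])
  hence "b \<le> 0" by (rule tendsto_lowerbound[OF inf]) simp
  ultimately have "a = 0" "b = 0" using f unfolding bernstein_triplet_def by auto
  thus ?thesis using f l unfolding bernstein_triplet_def by simp
qed

text \<open>A zero of f makes 1 - exp (- l t) vanish for almost every t, which is impossible for t >
  0 unless the measure is null; then f is 0 on (0, \<infinity>) and cannot tend to infinity.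
  Positivity makes 1 / f a true reciprocal, not the default value 0 of division by zero.\<close>

lemma bernstein_pure_jump_pos:
  assumes f: "\<And>l. l > 0 \<Longrightarrow> f l = (\<integral> t. (1 - exp (- l * t)) \<partial>\<mu>)" and levy: "levy_measure \<mu>"
    and top: "filterlim f at_top at_top" and l: "l > 0"
  shows "f l > 0"
proof -
  interpret levy_measure \<mu> by (rule levy)
  have "f l \<ge> 0" using one_minus_exp_integral_nonneg[OF l] f[OF l] by simp
  moreover have "f l \<noteq> 0"
  proof
    assume "f l = 0"
    hence "(\<integral> t. (1 - exp (- l * t)) \<partial>\<mu>) = 0" using f[OF l] by simp
    hence ae: "AE t in \<mu>. 1 - exp (- l * t) = 0"
      using one_minus_exp_integrable[OF l] l
      by (subst (asm) integral_nonneg_eq_0_iff_AE) (auto simp: space_levy)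
    have "f x = 0" if "x > 0" for x
    proof -
      have "AE t in \<mu>. 1 - exp (- x * t) = 0"
        using ae AE_space by eventually_elim (use l in \<open>auto simp: space_levy\<close>)
      thus ?thesis unfolding f[OF that] by (rule integral_eq_zero_AE)
    qed
    moreover have "eventually (\<lambda>x. f x > 0) at_top" using top by (simp add: filterlim_at_top_dense)
    hence "eventually (\<lambda>x. f x > 0 \<and> x > 0) at_top"
      using eventually_gt_at_top[of 0] by (rule eventually_conj)
    then obtain x where "f x > 0" "x > 0"
      using eventually_happens trivial_limit_at_top_linorder by blast
    ultimately show False by fastforce
  qed
  ultimately show ?thesis by simp
qed

theorem theorem3p4:
  fixes f :: "real \<Rightarrow> real" and a b a' b' :: real and \<mu> \<mu>' :: "real measure"
    and \<mu>bar k g :: "real \<Rightarrow> real" and \<phi>\<^sub>0 T :: real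
  assumes "complete_bernstein_triplet f a b \<mu>"
    and "(f \<longlongrightarrow> 0) (at_right 0)"
    and "filterlim f at_top at_top"
    and "filterlim (\<lambda>x. f x / x) at_top (at_right 0)"
    and "((\<lambda>x. f x / x) \<longlongrightarrow> 0) at_top"
    and "bernstein_triplet (conjugate_bernstein f) a' b' \<mu>'"
    and "\<mu>bar = levy_tail \<mu>"
    and "k = levy_tail \<mu>'"
    and "Limsup (at_right 0) (\<lambda>x. ereal (\<mu>bar x * (LBINT s:{0<..<x}. k s))) < 1"
    and "T > 0"
    and "continuous_on {0..T} g"
  shows "\<exists>\<phi>\<in>C_closed \<mu>bar T.
      (\<forall>x\<in>{0<..T}. censored_derivative \<mu>bar T \<phi> x = g x) \<and> \<phi> 0 = \<phi>\<^sub>0 \<and>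
      (\<forall>\<psi>\<in>C_closed \<mu>bar T.
         (\<forall>x\<in>{0<..T}. censored_derivative \<mu>bar T \<psi> x = g x) \<and> \<psi> 0 = \<phi>\<^sub>0 \<longrightarrow>
         (\<forall>x\<in>{0..T}. \<psi> x = \<phi> x)) \<and>
      (\<forall>x\<in>{0..T}. summable (\<lambda>i. (K_op \<mu>bar k ^^ i) (RL_integral k g) x) \<and>
         \<phi> x - \<phi>\<^sub>0 = censored_integral \<mu>bar k g x)"
proof -
  have f: "bernstein_triplet f a b \<mu>" using assms(1) by (simp add: complete_bernstein_triplet_def)
  obtain m where cm: "completely_monotone m"
    and \<mu>: "\<mu> = density (restrict_space lborel {0<..}) (\<lambda>t. ennreal (m t))"
    using assms(1) unfolding complete_bernstein_triplet_def by blast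
  note m = completely_monotone_antimono[OF cm] completely_monotone_nonneg[OF cm]
  have levy: "levy_measure \<mu>" "levy_measure \<mu>'"
    using f assms(6) unfolding bernstein_triplet_def levy_measure_def by blast+
  interpret \<mu>: levy_measure \<mu> by (rule levy)
  interpret \<mu>': levy_measure \<mu>' by (rule levy)
  note f_eq = bernstein_triplet_no_drift[OF f assms(2,5)]
  have f_pos: "f l > 0" if "l > 0" for l
    using f_eq levy(1) assms(3) that by (rule bernstein_pure_jump_pos)
  have conj_eq: "l / f l = (\<integral> t. (1 - exp (- l * t)) \<partial>\<mu>')" if "l > 0" for l
  proof -
    \<comment> \<open>The conjugate x / f x tends to 0 at 0 because f x / x tends to infinity there,
      and its quotient by x, which is 1 / f x, tends to 0 at infinity because f tends to infinity.
      So its triplet has neither constant nor drift.\<close>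
    have "((\<lambda>x. inverse (f x / x)) \<longlongrightarrow> 0) (at_right 0)"
      by (rule tendsto_inverse_0_at_top[OF assms(4)])
    hence 1: "(conjugate_bernstein f \<longlongrightarrow> 0) (at_right 0)"
      by (simp add: conjugate_bernstein_def[abs_def])
    have "((\<lambda>x. inverse (f x)) \<longlongrightarrow> 0) at_top"
      by (rule tendsto_inverse_0_at_top[OF assms(3)])
    moreover have "eventually (\<lambda>x. inverse (f x) = conjugate_bernstein f x / x) at_top"
      using eventually_gt_at_top[of 0]
      by eventually_elim (simp add: conjugate_bernstein_def field_simps)
    ultimately have 2: "((\<lambda>x. conjugate_bernstein f x / x) \<longlongrightarrow> 0) at_top"
      by (rule Lim_transform_eventually)
    show ?thesis
      using bernstein_triplet_no_drift[OF assms(6) 1 2 that] by (simp add: conjugate_bernstein_def)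
  qed
  have LA: "(\<integral>\<^sup>+ x. indicator {0<..} x * ennreal (exp (- l * x) * levy_tail \<mu> x) \<partial>lborel) = ennreal (f l / l)"
    if "l > 0" for l
    using \<mu>.Laplace_levy_tail[OF that] f_eq[OF that] by simp
  \<comment> \<open>The transform of the second tail is the conjugate divided by l, that is (l / f
    l) / l.\<close>
  have Lk: "(\<integral>\<^sup>+ x. indicator {0<..} x * ennreal (exp (- l * x) * levy_tail \<mu>' x) \<partial>lborel) = ennreal (1 / f l)"
    if "l > 0" for l
    using \<mu>'.Laplace_levy_tail[OF that] conj_eq[OF that, symmetric] that by simp
  have anti: "antimono_on {0<..} \<mu>bar" "antimono_on {0<..} k"
    and nonneg: "\<mu>bar x \<ge> 0" "k x \<ge> 0" for x
    unfolding assms(7,8) by (rule \<mu>.levy_tail_antimono \<mu>'.levy_tail_antimono \<mu>.levy_tail_nonneg \<mu>'.levy_tail_nonneg)+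
  interpret sonine_pair \<mu>bar k
  proof
    show "continuous_on {0<..} \<mu>bar"
      unfolding assms(7) using \<mu> levy(1) m by (rule continuous_on_levy_tail_density)
    show "set_integrable lborel {0<..<x} \<mu>bar" for x
      using LA[of 1] nonneg by (intro set_integrable_Ioo_Laplace[OF anti(1), of 1]) (auto simp: assms(7))
    show "set_integrable lborel {0<..<x} k" for x
      using Lk[of 1] nonneg by (intro set_integrable_Ioo_Laplace[OF anti(2), of 1]) (auto simp: assms(8))
    show "has_bochner_integral lborel (\<lambda>t. indicator {0<..<x} t * (\<mu>bar (x - t) * k t)) 1" if "x > 0" for x
    proof (rule Sonine_from_Laplace[OF anti(1) nonneg(1) anti(2) nonneg(2) _ that])
      fix l :: real assume l: "l > 0"
      have "ennreal (f l / l) * ennreal (1 / f l) = ennreal (1 / l)"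
        using f_pos[OF l] l by (simp add: ennreal_mult[symmetric] field_simps)
      thus "(\<integral>\<^sup>+ x. indicator {0<..} x * ennreal (exp (- l * x) * \<mu>bar x) \<partial>lborel) *
          (\<integral>\<^sup>+ x. indicator {0<..} x * ennreal (exp (- l * x) * k x) \<partial>lborel) = ennreal (1 / l)"
        unfolding assms(7,8) LA[OF l] Lk[OF l] .
    qed
  qed (rule nonneg)+
  have less: "\<mu>bar x * \<kappa> x < 1" if "x > 0" for x
  proof (rule mult_Ak_less_1[OF anti(1) that])
    fix y assume "0 < y" "y < x" "\<mu>bar y = \<mu>bar x"
    thus "\<mu>bar x = 0"
      unfolding assms(7) using levy_tail_density_eq_0[OF \<mu> levy(1) m] by blast
  qed
  obtain q where q: "0 \<le> q" "q < 1" "\<And>x. x \<in> {0<..T} \<Longrightarrow> \<mu>bar x * \<kappa> x \<le> q"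
    using ex_contraction_constant[OF assms(10) less] assms(9) unfolding \<kappa>_def by blast
  interpret sonine_contraction \<mu>bar k T q
    using assms(10) q by unfold_locales
  note ivp = censored_initial_value_problem[where \<phi>\<^sub>0 = \<phi>\<^sub>0, OF assms(11)]
  show ?thesis
  proof (intro bexI[OF _ ivp(1)] conjI ballI impI)
    fix \<psi> x assume "\<psi> \<in> C_closed \<mu>bar T"
      "(\<forall>x\<in>{0<..T}. censored_derivative \<mu>bar T \<psi> x = g x) \<and> \<psi> 0 = \<phi>\<^sub>0" "x \<in> {0..T}"
    thus "\<psi> x = \<phi>\<^sub>0 + censored_integral \<mu>bar k g x" by (intro ivp(4)) auto
  next
    fix x assume "x \<in> {0..T}"
    thus "summable (\<lambda>i. (K_op \<mu>bar k ^^ i) (RL_integral k g) x)"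
      by (rule censored_integral_properties(1)[OF assms(11)])
    show "\<phi>\<^sub>0 + censored_integral \<mu>bar k g x - \<phi>\<^sub>0 = censored_integral \<mu>bar k g x" by simp
  qed (rule ivp(2,3), assumption?)+
qed

end
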